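(* Let $n\ge 2$ be an even integer and let $G:=\mathrm{D}_{2n}\times\mathrm{C}_2$ be the direct product of the dihedral group $\mathrm{D}_{2n}$ of order $2n$ and the cyclic group $\mathrm{C}_2$ of order $2$. Let $K$ be a field having an element of multiplicative order $n$. Then \[\beta_{\mathrm{sep}}^K(\mathrm{D}_{2n}\times\mathrm{C}_2)=n+2.\]
   Context: Let $K$ be a field and $G$ a finite group. Throughout, $\mathrm{char}(K)$ does not divide $|G|$. A $KG$-module is a finite dimensional $K$-vector space $V$ with a representation $G\to\mathrm{GL}(V)$. $K[V]$ denotes the coordinate ring of $V$, identified with the polynomial algebra $K[x_1,\dots,x_n]$ in the coordinate functions on $V$ with respect to a basis (the symmetric algebra of $V^*$), with the standard grading. $G$ acts on $K[V]$ via $(g\cdot f)(v)=f(g^{-1}v)$; $K[V]^G$ is the algebra of invariants and $K[V]^G_{\le d}$ is the sum of its homogeneous components of degree at most $d$. A subset $S\subseteq K[V]^G$ is a separating set if for all $v,w\in V$, $f(v)=f(w)$ for all $f\in S$ implies that $v$ and $w$ have the same $G$-orbit. Put $\beta_{\mathrm{sep}}(G,V):=\min\{d\in\mathbb{N}_0\mid K[V]^G_{\le d}\text{ is a separating set}\}$ and $\beta_{\mathrm{sep}}^K(G):=\sup\{\beta_{\mathrm{sep}}(G,V)\mid V\text{ a finite dimensional }KG\text{-module}\}$. $\mathrm{D}_{2n}=\langle a,b\mid a^n=b^2=1,\ bab=a^{-1}\rangle$ (so $\mathrm{D}_4\cong\mathrm{C}_2\times\mathrm{C}_2$). *)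

theory Defs
  imports
    "HOL-Library.Poly_Mapping"
    "HOL-Library.Extended_Nat"
    "HOL-Algebra.Elementary_Groups"
    "HOL-Algebra.Generated_Groups"
    "Jordan_Normal_Form.Matrix"
begin

section \<open>Modules\<close>

text \<open>
  A module of dimension \<open>m\<close> over the group algebra is \<open>K\<^sup>m\<close> together with a matrix representation;
  after a choice of basis every finite dimensional module has this form.
\<close>

definition GL :: "'k::field itself \<Rightarrow> nat \<Rightarrow> 'k mat monoid" where
  "GL K m = units_of (ring_mat K m ())"

definition representation ::
    "('g, 'b) monoid_scheme \<Rightarrow> nat \<Rightarrow> ('g \<Rightarrow> 'k::field mat) \<Rightarrow> bool" where
  "representation G m \<rho> \<longleftrightarrow> \<rho> \<in> hom G (GL TYPE('k) m)"

definition same_orbit ::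
    "('g, 'b) monoid_scheme \<Rightarrow> ('g \<Rightarrow> 'k::field mat) \<Rightarrow> 'k vec \<Rightarrow> 'k vec \<Rightarrow> bool" where
  "same_orbit G \<rho> v w \<longleftrightarrow> (\<exists>g\<in>carrier G. w = \<rho> g *\<^sub>v v)"


section \<open>The coordinate ring\<close>

text \<open>
  Polynomials are formal: the ring \<open>'k mpoly\<close> has variables \<open>x\<^sub>0, x\<^sub>1, \<dots>\<close>, a monomial being its
  finitely supported family of exponents, and the coordinate ring of \<open>K\<^sup>m\<close> consists of the
  polynomials in which only \<open>x\<^sub>0, \<dots>, x\<^sub>m\<^sub>-\<^sub>1\<close> occur. Over a finite field it is not a ring of functions.
\<close>

type_synonym 'k mpoly = "(nat \<Rightarrow>\<^sub>0 nat) \<Rightarrow>\<^sub>0 'k"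

definition coord_ring :: "nat \<Rightarrow> 'k::field mpoly set" where
  "coord_ring m = {f. \<forall>t\<in>Poly_Mapping.keys f. Poly_Mapping.keys t \<subseteq> {..<m}}"

definition monom_degree :: "(nat \<Rightarrow>\<^sub>0 nat) \<Rightarrow> nat" where
  "monom_degree t = (\<Sum>i\<in>Poly_Mapping.keys t. Poly_Mapping.lookup t i)"

definition homogeneous :: "nat \<Rightarrow> 'k::field mpoly \<Rightarrow> bool" where
  "homogeneous d f \<longleftrightarrow> (\<forall>t\<in>Poly_Mapping.keys f. monom_degree t = d)"

text \<open>Coefficients are mapped by \<open>c\<close> and \<open>x\<^sub>i\<close> is replaced by \<open>x i\<close>.\<close>

definition mpoly_subst ::
    "('k::field \<Rightarrow> 'r::comm_ring_1) \<Rightarrow> (nat \<Rightarrow> 'r) \<Rightarrow> 'k mpoly \<Rightarrow> 'r" where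
  "mpoly_subst c x f =
     (\<Sum>t\<in>Poly_Mapping.keys f. c (Poly_Mapping.lookup f t) *
        (\<Prod>i\<in>Poly_Mapping.keys t. x i ^ Poly_Mapping.lookup t i))"

definition mpoly_eval :: "'k::field mpoly \<Rightarrow> 'k vec \<Rightarrow> 'k" where
  "mpoly_eval f v = mpoly_subst (\<lambda>a. a) (\<lambda>i. v $ i) f"

definition linear_form :: "nat \<Rightarrow> 'k::field mat \<Rightarrow> nat \<Rightarrow> 'k mpoly" where
  "linear_form m A i =
     (\<Sum>j<m. Poly_Mapping.single (Poly_Mapping.single j 1) (A $$ (i, j)))"

text \<open>
  \<open>(g \<cdot> f)(v) = f(g\<inverse>v)\<close> on formal polynomials: \<open>x\<^sub>i\<close> is replaced by the \<open>i\<close>-th coordinate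
  of \<open>g\<inverse>v\<close> as a linear form in \<open>v\<close>. The lemma \<open>mpoly_eval_action\<close> below is the formula for values.
\<close>

definition action ::
    "('g, 'b) monoid_scheme \<Rightarrow> nat \<Rightarrow> ('g \<Rightarrow> 'k::field mat) \<Rightarrow> 'g \<Rightarrow> 'k mpoly \<Rightarrow> 'k mpoly" where
  "action G m \<rho> g f =
     mpoly_subst (Poly_Mapping.single 0) (linear_form m (\<rho> (inv\<^bsub>G\<^esub> g))) f"

definition invariants ::
    "('g, 'b) monoid_scheme \<Rightarrow> nat \<Rightarrow> ('g \<Rightarrow> 'k::field mat) \<Rightarrow> 'k mpoly set" where
  "invariants G m \<rho> = {f \<in> coord_ring m. \<forall>g\<in>carrier G. action G m \<rho> g f = f}"

definition invariants_upto ::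
    "('g, 'b) monoid_scheme \<Rightarrow> nat \<Rightarrow> ('g \<Rightarrow> 'k::field mat) \<Rightarrow> nat \<Rightarrow> 'k mpoly set" where
  "invariants_upto G m \<rho> d =
     {\<Sum>j\<le>d. h j | h. \<forall>j\<le>d. h j \<in> invariants G m \<rho> \<and> homogeneous j (h j)}"


section \<open>Separating sets\<close>

definition separating_set ::
    "('g, 'b) monoid_scheme \<Rightarrow> nat \<Rightarrow> ('g \<Rightarrow> 'k::field mat) \<Rightarrow> 'k mpoly set \<Rightarrow> bool" where
  "separating_set G m \<rho> S \<longleftrightarrow>
     S \<subseteq> invariants G m \<rho> \<and>
     (\<forall>v\<in>carrier_vec m. \<forall>w\<in>carrier_vec m.
        (\<forall>f\<in>S. mpoly_eval f v = mpoly_eval f w) \<longrightarrow> same_orbit G \<rho> v w)"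

text \<open>
  The minimum is an infimum in \<^typ>\<open>enat\<close>: it is attained unless the set is empty, where it is
  \<open>\<infinity>\<close> rather than an arbitrary number.
\<close>

definition beta_sep_module ::
    "('g, 'b) monoid_scheme \<Rightarrow> nat \<Rightarrow> ('g \<Rightarrow> 'k::field mat) \<Rightarrow> enat" where
  "beta_sep_module G m \<rho> =
     (INF d\<in>{d. separating_set G m \<rho> (invariants_upto G m \<rho> d)}. enat d)"

definition beta_sep :: "'k::field itself \<Rightarrow> ('g, 'b) monoid_scheme \<Rightarrow> enat" where
  "beta_sep K G =
     (SUP (m, \<rho>)\<in>{(m, \<rho> :: 'g \<Rightarrow> 'k mat). representation G m \<rho>}. beta_sep_module G m \<rho>)"


section \<open>Dihedral groups\<close>

text \<open>
  For \<open>n > 0\<close>, the pair \<open>(i, s)\<close> stands for \<open>a\<^sup>i\<close> if \<open>s\<close> is false and for \<open>a\<^sup>i b\<close> if \<open>s\<close> is true.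
\<close>

definition dihedral_group :: "nat \<Rightarrow> (int \<times> bool) monoid" where
  "dihedral_group n =
     \<lparr>carrier = {0..<int n} \<times> UNIV,
      monoid.mult = (\<lambda>(i, s) (j, t). ((if s then i - j else i + j) mod int n, s \<noteq> t)),
      one = (0, False)\<rparr>"

definition dihedral_a :: "nat \<Rightarrow> int \<times> bool" where
  "dihedral_a n = (1 mod int n, False)"

definition dihedral_b :: "int \<times> bool" where
  "dihedral_b = (0, True)"


section \<open>The dihedral group has its presentation\<close>

lemma dihedral_carrier: "carrier (dihedral_group n) = {0..<int n} \<times> UNIV"
  by (simp add: dihedral_group_def)

lemma dihedral_one: "\<one>\<^bsub>dihedral_group n\<^esub> = (0, False)"
  by (simp add: dihedral_group_def)

lemma dihedral_mult:
  "(i, s) \<otimes>\<^bsub>dihedral_group n\<^esub> (j, t) = ((if s then i - j else i + j) mod int n, s \<noteq> t)"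
  by (simp add: dihedral_group_def)

lemma dihedral_is_group:
  assumes "n > 0"
  shows "group (dihedral_group n)"
proof (rule groupI)
  fix x assume "x \<in> carrier (dihedral_group n)"
  then obtain i s where x: "x = (i, s)" and i: "0 \<le> i" "i < int n"
    by (auto simp: dihedral_carrier)
  show "\<exists>y\<in>carrier (dihedral_group n). y \<otimes>\<^bsub>dihedral_group n\<^esub> x = \<one>\<^bsub>dihedral_group n\<^esub>"
  proof (cases s)
    case True
    then show ?thesis
      using i assms by (intro bexI[of _ x]) (auto simp: x dihedral_carrier dihedral_one dihedral_mult)
  next
    case False
    then show ?thesis
      using i assms
      by (intro bexI[of _ "((- i) mod int n, False)"])
         (auto simp: x dihedral_carrier dihedral_one dihedral_mult mod_simps)
  qed
qed (use assms in \<open>auto simp: dihedral_carrier dihedral_one dihedral_mult mod_simps algebra_simps\<close>)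

lemma dihedral_order: "order (dihedral_group n) = 2 * n"
  by (simp add: order_def dihedral_carrier card_cartesian_product)

lemma dihedral_a_pow:
  assumes "n > 0"
  shows "dihedral_a n [^]\<^bsub>dihedral_group n\<^esub> (k::nat) = (int k mod int n, False)"
proof -
  interpret group "dihedral_group n" using assms by (rule dihedral_is_group)
  show ?thesis
    by (induction k) (auto simp: dihedral_one dihedral_a_def dihedral_mult mod_simps algebra_simps)
qed

lemma dihedral_relations:
  assumes "n > 0"
  defines "G \<equiv> dihedral_group n" and "a \<equiv> dihedral_a n" and "b \<equiv> dihedral_b"
  shows "a \<in> carrier G" and "b \<in> carrier G"
    and "a [^]\<^bsub>G\<^esub> n = \<one>\<^bsub>G\<^esub>" and "b [^]\<^bsub>G\<^esub> (2::nat) = \<one>\<^bsub>G\<^esub>"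
    and "b \<otimes>\<^bsub>G\<^esub> a \<otimes>\<^bsub>G\<^esub> b = inv\<^bsub>G\<^esub> a"
    and "generate G {a, b} = carrier G"
proof -
  interpret group G unfolding G_def using assms(1) by (rule dihedral_is_group)
  show a: "a \<in> carrier G" and b: "b \<in> carrier G"
    using assms(1) by (auto simp: G_def a_def b_def dihedral_carrier dihedral_a_def dihedral_b_def)
  show "a [^]\<^bsub>G\<^esub> n = \<one>\<^bsub>G\<^esub>"
    unfolding G_def a_def by (simp add: dihedral_a_pow[OF assms(1)] dihedral_one)
  show "b [^]\<^bsub>G\<^esub> (2::nat) = \<one>\<^bsub>G\<^esub>"
    using b by (simp add: numeral_2_eq_2) (simp add: G_def b_def dihedral_b_def dihedral_one dihedral_mult)
  have "b \<otimes>\<^bsub>G\<^esub> a \<otimes>\<^bsub>G\<^esub> b \<otimes>\<^bsub>G\<^esub> a = \<one>\<^bsub>G\<^esub>"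
    by (simp add: G_def a_def b_def dihedral_a_def dihedral_b_def dihedral_one dihedral_mult mod_simps)
  then show "b \<otimes>\<^bsub>G\<^esub> a \<otimes>\<^bsub>G\<^esub> b = inv\<^bsub>G\<^esub> a"
    using a b by (metis inv_equality m_closed)
  have pow: "a [^]\<^bsub>G\<^esub> (k::nat) \<in> generate G {a, b}" for k
    by (induction k) (auto intro: generate.intros)
  show "generate G {a, b} = carrier G"
  proof
    show "generate G {a, b} \<subseteq> carrier G"
      using a b by (intro generate_incl) auto
    show "carrier G \<subseteq> generate G {a, b}"
    proof
      fix x assume "x \<in> carrier G"
      then obtain i s where x: "x = (i, s)" and i: "0 \<le> i" "i < int n"
        by (auto simp: G_def dihedral_carrier)
      have ai: "a [^]\<^bsub>G\<^esub> nat i = (i, False)"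
        using i by (simp add: G_def a_def dihedral_a_pow[OF assms(1)])
      show "x \<in> generate G {a, b}"
      proof (cases s)
        case True
        then have "x = a [^]\<^bsub>G\<^esub> nat i \<otimes>\<^bsub>G\<^esub> b"
          using i by (simp add: ai x) (simp add: G_def b_def dihedral_b_def dihedral_mult)
        then show ?thesis
          using pow by (auto intro: generate.intros)
      next
        case False
        then show ?thesis using pow[of "nat i"] by (simp add: ai x)
      qed
    qed
  qed
qed

lemma dihedral_universal:
  assumes "n > 0" and "group H" and x: "x \<in> carrier H" and y: "y \<in> carrier H"
    and xn: "x [^]\<^bsub>H\<^esub> n = \<one>\<^bsub>H\<^esub>" and yy: "y [^]\<^bsub>H\<^esub> (2::nat) = \<one>\<^bsub>H\<^esub>"
    and yxy: "y \<otimes>\<^bsub>H\<^esub> x \<otimes>\<^bsub>H\<^esub> y = inv\<^bsub>H\<^esub> x"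
  shows "\<exists>h\<in>hom (dihedral_group n) H. h (dihedral_a n) = x \<and> h dihedral_b = y"
proof -
  interpret H: group H by fact
  define h where "h = (\<lambda>(i::int, s). x [^]\<^bsub>H\<^esub> i \<otimes>\<^bsub>H\<^esub> (if s then y else \<one>\<^bsub>H\<^esub>))"
  have y2: "y \<otimes>\<^bsub>H\<^esub> y = \<one>\<^bsub>H\<^esub>" using yy y by (simp add: numeral_2_eq_2)
  have pmod: "x [^]\<^bsub>H\<^esub> (i mod int n) = x [^]\<^bsub>H\<^esub> i" for i :: int
  proof -
    have "x [^]\<^bsub>H\<^esub> i = x [^]\<^bsub>H\<^esub> (int n * (i div int n) + i mod int n)" by simp
    also have "\<dots> = (x [^]\<^bsub>H\<^esub> (int n)) [^]\<^bsub>H\<^esub> (i div int n) \<otimes>\<^bsub>H\<^esub> x [^]\<^bsub>H\<^esub> (i mod int n)"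
      using x by (simp only: H.int_pow_mult H.int_pow_pow)
    also have "\<dots> = x [^]\<^bsub>H\<^esub> (i mod int n)"
      using x xn by (simp add: int_pow_int)
    finally show ?thesis by simp
  qed
  have conj_nat: "y \<otimes>\<^bsub>H\<^esub> x [^]\<^bsub>H\<^esub> (k::nat) = inv\<^bsub>H\<^esub> x [^]\<^bsub>H\<^esub> k \<otimes>\<^bsub>H\<^esub> y" for k
  proof (induction k)
    case 0
    show ?case using y by simp
  next
    case (Suc k)
    have yx: "y \<otimes>\<^bsub>H\<^esub> x = inv\<^bsub>H\<^esub> x \<otimes>\<^bsub>H\<^esub> y"
      using yxy y2 x y by (metis H.m_assoc H.m_closed H.r_one)
    have "y \<otimes>\<^bsub>H\<^esub> x [^]\<^bsub>H\<^esub> Suc k = (y \<otimes>\<^bsub>H\<^esub> x [^]\<^bsub>H\<^esub> k) \<otimes>\<^bsub>H\<^esub> x"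
      using x y by (simp add: H.m_assoc)
    also have "\<dots> = inv\<^bsub>H\<^esub> x [^]\<^bsub>H\<^esub> k \<otimes>\<^bsub>H\<^esub> (y \<otimes>\<^bsub>H\<^esub> x)"
      using x y by (simp add: Suc H.m_assoc)
    also have "\<dots> = inv\<^bsub>H\<^esub> x [^]\<^bsub>H\<^esub> Suc k \<otimes>\<^bsub>H\<^esub> y"
      using x y by (simp add: yx H.m_assoc)
    finally show ?case .
  qed
  have conj_int: "y \<otimes>\<^bsub>H\<^esub> x [^]\<^bsub>H\<^esub> j = x [^]\<^bsub>H\<^esub> (- j) \<otimes>\<^bsub>H\<^esub> y" if "0 \<le> j" for j :: int
    using conj_nat[of "nat j"] that x
    by (simp add: H.int_pow_neg H.int_pow_inv flip: int_pow_int)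
  have "h \<in> hom (dihedral_group n) H"
  proof (rule homI)
    show "h z \<in> carrier H" for z
      using x y by (auto simp: h_def split: prod.splits)
  next
    fix p q assume "p \<in> carrier (dihedral_group n)" "q \<in> carrier (dihedral_group n)"
    then obtain i s j t where p: "p = (i, s)" and q: "q = (j, t)" and j: "0 \<le> j"
      by (auto simp: dihedral_carrier)
    have r: "x [^]\<^bsub>H\<^esub> i \<otimes>\<^bsub>H\<^esub> y \<otimes>\<^bsub>H\<^esub> (x [^]\<^bsub>H\<^esub> j \<otimes>\<^bsub>H\<^esub> z) = x [^]\<^bsub>H\<^esub> (i - j) \<otimes>\<^bsub>H\<^esub> (y \<otimes>\<^bsub>H\<^esub> z)"
      if "z \<in> carrier H" for z
    proof -
      have "x [^]\<^bsub>H\<^esub> i \<otimes>\<^bsub>H\<^esub> y \<otimes>\<^bsub>H\<^esub> (x [^]\<^bsub>H\<^esub> j \<otimes>\<^bsub>H\<^esub> z) = x [^]\<^bsub>H\<^esub> i \<otimes>\<^bsub>H\<^esub> (y \<otimes>\<^bsub>H\<^esub> x [^]\<^bsub>H\<^esub> j) \<otimes>\<^bsub>H\<^esub> z"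
        using x y that by (simp add: H.m_assoc)
      also have "\<dots> = (x [^]\<^bsub>H\<^esub> i \<otimes>\<^bsub>H\<^esub> x [^]\<^bsub>H\<^esub> (- j)) \<otimes>\<^bsub>H\<^esub> (y \<otimes>\<^bsub>H\<^esub> z)"
        unfolding conj_int[OF j] using x y that by (simp add: H.m_assoc)
      also have "x [^]\<^bsub>H\<^esub> i \<otimes>\<^bsub>H\<^esub> x [^]\<^bsub>H\<^esub> (- j) = x [^]\<^bsub>H\<^esub> (i - j)"
        using H.int_pow_mult[OF x, of i "- j"] by simp
      finally show ?thesis .
    qed
    have l: "x [^]\<^bsub>H\<^esub> i \<otimes>\<^bsub>H\<^esub> (x [^]\<^bsub>H\<^esub> j \<otimes>\<^bsub>H\<^esub> z) = x [^]\<^bsub>H\<^esub> (i + j) \<otimes>\<^bsub>H\<^esub> z"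
      if "z \<in> carrier H" for z
      using x that by (simp add: H.int_pow_mult H.m_assoc)
    show "h (p \<otimes>\<^bsub>dihedral_group n\<^esub> q) = h p \<otimes>\<^bsub>H\<^esub> h q"
      using x y y2 r l r[OF H.one_closed] l[OF H.one_closed]
      by (cases s; cases t) (simp_all add: p q h_def dihedral_mult pmod)
  qed
  moreover have "h (dihedral_a n) = x" "h dihedral_b = y"
    using x y by (simp_all add: h_def dihedral_a_def dihedral_b_def pmod)
  ultimately show ?thesis by blast
qed


section \<open>Values of the action\<close>

lemma mpoly_subst_add:
  assumes "c 0 = 0" and "\<And>a b. c (a + b) = c a + c b"
  shows "mpoly_subst c x (f + g) = mpoly_subst c x f + mpoly_subst c x g"
  unfolding mpoly_subst_def
  by (rule setsum_keys_plus_distrib) (auto simp: assms algebra_simps)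

lemma mpoly_subst_sum:
  assumes "c 0 = 0" and "\<And>a b. c (a + b) = c a + c b"
  shows "mpoly_subst c x (\<Sum>i\<in>I. f i) = (\<Sum>i\<in>I. mpoly_subst c x (f i))"
  by (induction I rule: infinite_finite_induct)
     (simp_all add: mpoly_subst_add[OF assms], simp_all add: mpoly_subst_def)

lemma mpoly_subst_single:
  assumes "c 0 = 0"
  shows "mpoly_subst c x (Poly_Mapping.single t a) =
    c a * (\<Prod>i\<in>Poly_Mapping.keys t. x i ^ Poly_Mapping.lookup t i)"
  by (cases "a = 0") (auto simp: mpoly_subst_def assms)

lemma monom_value_add:
  fixes x :: "nat \<Rightarrow> 'r::comm_ring_1"
  shows "(\<Prod>i\<in>Poly_Mapping.keys (s + t). x i ^ Poly_Mapping.lookup (s + t) i) =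
    (\<Prod>i\<in>Poly_Mapping.keys s. x i ^ Poly_Mapping.lookup s i) *
    (\<Prod>i\<in>Poly_Mapping.keys t. x i ^ Poly_Mapping.lookup t i)"
proof -
  let ?U = "Poly_Mapping.keys s \<union> Poly_Mapping.keys t"
  have ext: "(\<Prod>i\<in>Poly_Mapping.keys u. x i ^ Poly_Mapping.lookup u i) =
      (\<Prod>i\<in>?U. x i ^ Poly_Mapping.lookup u i)" if "Poly_Mapping.keys u \<subseteq> ?U" for u
    using that by (intro prod.mono_neutral_left) (auto simp: in_keys_iff)
  show ?thesis
    unfolding ext[OF Poly_Mapping.keys_add] ext[OF Un_upper1] ext[OF Un_upper2]
    by (simp add: lookup_add power_add prod.distrib)
qed

lemma mpoly_sum_monomials:
  "f = (\<Sum>t\<in>Poly_Mapping.keys f. Poly_Mapping.single t (Poly_Mapping.lookup f t))"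
  by (rule poly_mapping_eqI)
     (auto simp: lookup_sum lookup_single when_def in_keys_iff)

lemma mpoly_subst_mult:
  assumes c: "c 0 = 0" "\<And>a b. c (a + b) = c a + c b" "\<And>a b. c (a * b) = c a * c b"
  shows "mpoly_subst c x (f * g) = mpoly_subst c x f * mpoly_subst c x g"
proof -
  let ?m = "\<lambda>h t. Poly_Mapping.single t (Poly_Mapping.lookup h t)"
  have single: "mpoly_subst c x (Poly_Mapping.single s a * Poly_Mapping.single t b) =
      mpoly_subst c x (Poly_Mapping.single s a) * mpoly_subst c x (Poly_Mapping.single t b)" for s t a b
    by (simp add: mult_single mpoly_subst_single[of c] c monom_value_add algebra_simps)
  have "f * g = (\<Sum>s\<in>Poly_Mapping.keys f. \<Sum>t\<in>Poly_Mapping.keys g. ?m f s * ?m g t)"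
    by (subst mpoly_sum_monomials[of f], subst mpoly_sum_monomials[of g]) (rule sum_product)
  then have "mpoly_subst c x (f * g) =
      (\<Sum>s\<in>Poly_Mapping.keys f. \<Sum>t\<in>Poly_Mapping.keys g.
         mpoly_subst c x (?m f s) * mpoly_subst c x (?m g t))"
    by (simp add: mpoly_subst_sum[of c] c single)
  also have "\<dots> = (\<Sum>s\<in>Poly_Mapping.keys f. mpoly_subst c x (?m f s)) *
      (\<Sum>t\<in>Poly_Mapping.keys g. mpoly_subst c x (?m g t))"
    by (simp add: sum_product)
  also have "\<dots> = mpoly_subst c x f * mpoly_subst c x g"
    using mpoly_subst_sum[of c x "?m f" "Poly_Mapping.keys f"]
      mpoly_subst_sum[of c x "?m g" "Poly_Mapping.keys g"] c
      mpoly_sum_monomials[of f] mpoly_sum_monomials[of g] by simp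
  finally show ?thesis .
qed

lemma mpoly_eval_add: "mpoly_eval (f + g) v = mpoly_eval f v + mpoly_eval g v"
  unfolding mpoly_eval_def by (rule mpoly_subst_add) auto

lemma mpoly_eval_sum: "mpoly_eval (\<Sum>i\<in>I. f i) v = (\<Sum>i\<in>I. mpoly_eval (f i) v)"
  unfolding mpoly_eval_def by (rule mpoly_subst_sum) auto

lemma mpoly_eval_mult: "mpoly_eval (f * g) v = mpoly_eval f v * mpoly_eval g v"
  unfolding mpoly_eval_def by (rule mpoly_subst_mult) auto

lemma mpoly_eval_const: "mpoly_eval (Poly_Mapping.single 0 a) v = a"
  unfolding mpoly_eval_def by (subst mpoly_subst_single) auto

lemma mpoly_eval_one: "mpoly_eval 1 v = 1"
  using mpoly_eval_const[of 1 v] by simp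

lemma mpoly_eval_power: "mpoly_eval (f ^ k) v = mpoly_eval f v ^ k"
  by (induction k) (simp_all add: mpoly_eval_one mpoly_eval_mult)

lemma mpoly_eval_prod: "mpoly_eval (\<Prod>i\<in>I. f i) v = (\<Prod>i\<in>I. mpoly_eval (f i) v)"
  by (induction I rule: infinite_finite_induct) (simp_all add: mpoly_eval_one mpoly_eval_mult)

lemma mpoly_eval_linear_form:
  assumes "A \<in> carrier_mat m m" and "v \<in> carrier_vec m" and "i < m"
  shows "mpoly_eval (linear_form m A i) v = (A *\<^sub>v v) $ i"
proof -
  have "mpoly_eval (linear_form m A i) v = (\<Sum>j<m. A $$ (i, j) * v $ j)"
    unfolding linear_form_def mpoly_eval_sum
    by (rule sum.cong) (auto simp: mpoly_eval_def mpoly_subst_single)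
  also have "\<dots> = (A *\<^sub>v v) $ i"
    using assms by (auto simp: scalar_prod_def lessThan_atLeast0 intro!: sum.cong)
  finally show ?thesis .
qed

lemma representation_carrier:
  fixes \<rho> :: "'g \<Rightarrow> 'k::field mat"
  assumes "representation G m \<rho>" and "g \<in> carrier G"
  shows "\<rho> g \<in> carrier_mat m m"
  using hom_in_carrier[of \<rho> G "GL TYPE('k) m" g] assms
  by (auto simp: representation_def GL_def units_of_def Units_def ring_mat_def)

lemma mpoly_eval_action:
  assumes "group G" and "representation G m \<rho>" and "g \<in> carrier G"
    and "f \<in> coord_ring m" and "v \<in> carrier_vec m"
  shows "mpoly_eval (action G m \<rho> g f) v = mpoly_eval f (\<rho> (inv\<^bsub>G\<^esub> g) *\<^sub>v v)"
proof -
  interpret group G by fact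
  let ?A = "\<rho> (inv\<^bsub>G\<^esub> g)"
  have A: "?A \<in> carrier_mat m m"
    using assms by (intro representation_carrier) auto
  have "mpoly_eval (action G m \<rho> g f) v =
      (\<Sum>t\<in>Poly_Mapping.keys f. Poly_Mapping.lookup f t *
        (\<Prod>i\<in>Poly_Mapping.keys t. mpoly_eval (linear_form m ?A i) v ^ Poly_Mapping.lookup t i))"
    by (simp add: action_def mpoly_subst_def mpoly_eval_sum mpoly_eval_mult mpoly_eval_const
        mpoly_eval_prod mpoly_eval_power)
  also have "\<dots> = (\<Sum>t\<in>Poly_Mapping.keys f. Poly_Mapping.lookup f t *
        (\<Prod>i\<in>Poly_Mapping.keys t. (?A *\<^sub>v v) $ i ^ Poly_Mapping.lookup t i))"
    using assms(4)
    by (intro sum.cong prod.cong refl arg_cong2[where f = "(*)"] arg_cong2[where f = "(^)"]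
        mpoly_eval_linear_form[OF A assms(5)]) (auto simp: coord_ring_def)
  also have "\<dots> = mpoly_eval f (?A *\<^sub>v v)"
    by (simp add: mpoly_eval_def mpoly_subst_def)
  finally show ?thesis .
qed

end

theory Submission
  imports "HOL-Computational_Algebra.Polynomial" Defs
begin

text \<open>
  Write \<open>G = D\<^sub>2\<^sub>n \<times> C\<^sub>2 = \<langle>a, b, c\<rangle>\<close> with \<open>c\<close> the generator of the second factor, and \<open>A = \<langle>a, c\<rangle>\<close>, an
  abelian subgroup of index 2 and order \<open>2n\<close> in which every order divides \<open>n\<close>.

  Upper bound. Let \<open>v\<close>, \<open>w\<close> be vectors of a module on which all invariants of degree at most \<open>n + 2\<close>
  agree. As \<open>K\<close> contains a primitive \<open>n\<close>-th root of unity and \<open>2n\<close> is invertible, every linear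
  functional is a sum of weight functionals, that is, eigenvectors of \<open>A\<close>
  (\<open>weight_funs_separate\<close>). For a list \<open>M\<close> of weight functionals let \<open>x(M)\<close>, \<open>y(M)\<close>, \<open>x'(M)\<close>,
  \<open>y'(M)\<close> be the product of their values at \<open>v\<close>, \<open>bv\<close>, \<open>w\<close>, \<open>bw\<close>. If the weights in \<open>M\<close> multiply to
  1, so that \<open>M\<close> is neutral, then summing the product over \<open>G\<close> shows
  \<open>x(M) + y(M) = x'(M) + y'(M)\<close> whenever \<open>M\<close> has length at most \<open>n + 2\<close>. On the other hand the
  neutral products of arbitrary length separate the orbits of \<open>A\<close>
  (\<open>neutral_products_separate_orbits\<close>). Hence it suffices to prove that \<open>x(M) = x'(M)\<close> for all neutral
  \<open>M\<close>, which puts \<open>w\<close> into the \<open>A\<close>-orbit of \<open>v\<close>, or \<open>y(M) = x'(M)\<close> for all neutral \<open>M\<close>, which puts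
  \<open>w\<close> into the \<open>A\<close>-orbit of \<open>bv\<close>. This is \<open>neutral_products_agree\<close>.

  For finitely many weight functionals, the integer exponent vectors with trivial weight form a lattice
  of index at most \<open>2n\<close> that contains \<open>n\<close> times each unit vector. Such a lattice has a triangular basis
  \<open>v\<^sub>0, v\<^sub>1, \<dots>\<close> with diagonal entries \<open>a\<^sub>i\<close>, with entries below \<open>a\<^sub>j\<close> in column \<open>j\<close> off the diagonal, and
  with \<open>\<Sum>(a\<^sub>j - 1) \<le> n\<close> (\<open>reduced_lattice_basis\<close>). So a difference of two basis vectors has
  \<open>\<ell>\<^sub>1\<close>-norm at most \<open>\<Sum>(a\<^sub>j - 1) + 2 \<le> n + 2\<close>; this is where the bound comes from. Negative exponents
  make sense because composing a functional with \<open>b\<close> inverts its weight and exchanges its values \<open>x\<close>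
  and \<open>y\<close>, and \<open>x y = x' y'\<close> holds for each functional.

  If some weight functional has \<open>x \<noteq> 0 = y\<close>, then the products through this functional have only one
  nonzero term on each side, and the basis vectors, corrected so as to pass through it, give
  \<open>x(M) = x'(M)\<close> directly (\<open>one_sided_case\<close>), up to exchanging \<open>w\<close> and \<open>bw\<close>. Otherwise each neutral
  vector of norm at most \<open>n + 2\<close> is in the kernel of one of two homomorphisms on the lattice, the ones
  given by \<open>x'/x\<close> and \<open>x'/y\<close>. If neither kernel were the whole lattice, each would miss a basis vector, and
  the difference of these two basis vectors would be a short vector outside both kernels
  (\<open>two_sided_case\<close>).

  Lower bound. Let \<open>G\<close> act on \<open>K\<^sup>4\<close> with coordinates \<open>x, y, s, t\<close> so that \<open>a\<close> multiplies \<open>x\<close> by \<open>\<zeta>\<close> and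
  \<open>y\<close> by \<open>\<zeta>\<inverse>\<close>, \<open>b\<close> exchanges \<open>x\<close> and \<open>y\<close> and negates \<open>s\<close>, and \<open>c\<close> negates \<open>s\<close> and \<open>t\<close>. The points
  \<open>(1, 0, 1, 1)\<close> and \<open>(1, 0, 1, -1)\<close> are in different orbits, but the first invariant that tells them
  apart is \<open>(x\<^sup>n - y\<^sup>n) s t\<close>.
\<close>

section \<open>Reduced bases of lattices of small index\<close>

lemma sum_pred_less_prod:
  fixes a :: "nat \<Rightarrow> nat"
  assumes "\<And>j. j < r \<Longrightarrow> 1 \<le> a j"
  shows "(\<Sum>j<r. a j - 1) + 1 \<le> (\<Prod>j<r. a j)"
  using assms
proof (induction r)
  case (Suc r)
  define P where "P = (\<Prod>j<r. a j)"
  have ih: "(\<Sum>j<r. a j - 1) + 1 \<le> P" using Suc by (simp add: P_def)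
  obtain b where b: "a r = Suc b" using Suc.prems[of r] by (cases "a r") auto
  have "b \<le> P * b" using ih by (cases P) auto
  with ih have "(\<Sum>j<r. a j - 1) + b + 1 \<le> P * Suc b" by (simp only: mult_Suc_right)
  then show ?case by (simp add: P_def b)
qed simp

text \<open>
  If two factors or more exceed 1, the product splits as \<open>P a\<close> with \<open>P, a \<ge> 2\<close>, and then
  \<open>(P - 1) + (a - 1) \<le> P a / 2\<close>. A single factor is at most \<open>n\<close> by assumption; this case is the reason
  for the bound on the individual factors.
\<close>

lemma sum_pred_le_of_prod_le:
  fixes a :: "nat \<Rightarrow> nat"
  assumes "\<And>j. j < r \<Longrightarrow> 1 \<le> a j" and "\<And>j. j < r \<Longrightarrow> a j \<le> n"
    and "(\<Prod>j<r. a j) \<le> 2 * n"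
  shows "(\<Sum>j<r. a j - 1) \<le> n"
  using assms
proof (induction r)
  case (Suc r)
  define P where "P = (\<Prod>j<r. a j)"
  define S where "S = (\<Sum>j<r. a j - 1)"
  have S: "S + 1 \<le> P" using sum_pred_less_prod[of r a] Suc.prems by (simp add: P_def S_def)
  have a: "1 \<le> a r" "a r \<le> n" using Suc.prems by auto
  have prod: "P * a r \<le> 2 * n" using Suc.prems(3) by (simp add: P_def)
  consider "a r = 1" | "P = 1" | "a r \<ge> 2" "P \<ge> 2" using a S by linarith
  then show ?case
  proof cases
    case 1
    then have "S \<le> n" unfolding S_def using Suc by simp
    with 1 show ?thesis by (simp add: S_def)
  next
    case 2
    with S a show ?thesis by (simp add: S_def)
  next
    case 3
    obtain x where x: "a r = x + 2" using 3 by (metis le_add_diff_inverse2)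
    obtain y where y: "P = y + 2" using 3 by (metis le_add_diff_inverse2)
    have "2 * (x + y + 2) \<le> P * a r" unfolding x y by (simp add: algebra_simps)
    with prod S have "S + (a r - 1) \<le> n" by (simp add: x y)
    then show ?thesis by (simp add: S_def)
  qed
qed simp

text \<open>
  The diagonal entry \<open>a k\<close> is the least positive leading coefficient of a vector of \<open>L\<close> whose last
  nonzero position is \<open>k\<close>; all other leading coefficients at \<open>k\<close> are multiples of it. The entries before
  the diagonal can be reduced modulo the \<open>a j\<close>. No two vectors in the box \<open>0 \<le> x j < a j\<close> are congruent
  modulo \<open>L\<close>, so the index bounds the product of the diagonal, and the previous lemma turns this into a
  bound for the sum. The index hypothesis says that \<open>L\<close> has at most \<open>2 * n\<close> cosets, in a form that needs no quotient.
\<close>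

lemma reduced_lattice_basis:
  fixes L :: "(nat \<Rightarrow> int) set" and n r :: nat
  assumes zero: "(\<lambda>_. 0) \<in> L"
    and diff: "\<And>u v. u \<in> L \<Longrightarrow> v \<in> L \<Longrightarrow> (\<lambda>j. u j - v j) \<in> L"
    and expo: "\<And>j. j < r \<Longrightarrow> (\<lambda>i. if i = j then int n else 0) \<in> L" and n: "n > 0"
    and index: "\<And>X. finite X \<Longrightarrow> card X > 2 * n \<Longrightarrow> \<exists>x\<in>X. \<exists>y\<in>X. x \<noteq> y \<and> (\<lambda>j. x j - y j) \<in> L"
  obtains a :: "nat \<Rightarrow> nat" and v :: "nat \<Rightarrow> nat \<Rightarrow> int"
  where "\<And>i. i < r \<Longrightarrow> 1 \<le> a i" and "\<And>i. i < r \<Longrightarrow> v i \<in> L"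
    and "\<And>i. i < r \<Longrightarrow> v i i = int (a i)" and "\<And>i j. i < r \<Longrightarrow> i < j \<Longrightarrow> v i j = 0"
    and "\<And>i j. i < r \<Longrightarrow> j < i \<Longrightarrow> 0 \<le> v i j \<and> v i j < int (a j)"
    and "(\<Sum>j<r. a j - 1) \<le> n"
    and "\<And>u. u \<in> L \<Longrightarrow> \<forall>j\<ge>r. u j = 0 \<Longrightarrow> \<exists>c. \<forall>j. u j = (\<Sum>i<r. c i * v i j)"
proof -
  have neg: "(\<lambda>j. - u j) \<in> L" if "u \<in> L" for u
    using diff[OF zero that] by simp
  have add: "(\<lambda>j. u j + v j) \<in> L" if "u \<in> L" "v \<in> L" for u v
    using diff[OF that(1) neg[OF that(2)]] by simp
  have nat_mult: "(\<lambda>j. int k * u j) \<in> L" if "u \<in> L" for u and k :: nat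
  proof (induction k)
    case (Suc k)
    show ?case using add[OF that Suc] by (simp add: algebra_simps)
  qed (simp add: zero)
  have mult: "(\<lambda>j. c * u j) \<in> L" if "u \<in> L" for u and c :: int
    using nat_mult[OF that, of "nat c"] neg[OF nat_mult[OF that, of "nat (- c)"]]
    by (cases "c \<ge> 0") auto
  define Lead where "Lead k = {u \<in> L. \<forall>j>k. u j = 0}" for k
  \<comment> \<open>Q k b: b is a positive leading coefficient at position k\<close>
  define Q where "Q k b \<longleftrightarrow> 1 \<le> b \<and> (\<exists>u\<in>Lead k. u k = int b)" for k b
  define a where "a k = (LEAST b. Q k b)" for k
  have Qn: "Q k n" if "k < r" for k
    unfolding Q_def Lead_def using expo[OF that] n by (intro conjI bexI[of _ "\<lambda>i. if i = k then int n else 0"]) auto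
  have Qa: "Q k (a k)" if "k < r" for k
    unfolding a_def by (rule LeastI[of "Q k", OF Qn[OF that]])
  have a_le: "a k \<le> n" if "k < r" for k
    unfolding a_def by (rule Least_le[of "Q k", OF Qn[OF that]])
  have a1: "1 \<le> a k" if "k < r" for k
    using Qa[OF that] by (simp add: Q_def)
  have "\<forall>k. \<exists>u. k < r \<longrightarrow> u \<in> Lead k \<and> u k = int (a k)"
    using Qa by (auto simp: Q_def)
  then obtain w where w: "\<And>k. k < r \<Longrightarrow> w k \<in> Lead k" "\<And>k. k < r \<Longrightarrow> w k k = int (a k)"
    by metis
  have step: "(\<lambda>j. u j - c * w k j) \<in> L" if "u \<in> L" "k < r" for u c k
    using diff[OF that(1) mult[of "w k" c]] w(1)[OF that(2)] by (simp add: Lead_def)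
  have dvd: "int (a k) dvd u k" if "k < r" "u \<in> Lead k" for u k
  proof (rule ccontr)
    assume nd: "\<not> int (a k) dvd u k"
    define u' where "u' = (\<lambda>j. u j - (u k div int (a k)) * w k j)"
    have "u' \<in> Lead k"
      using that step[of u k "u k div int (a k)"] w(1)[OF that(1)] by (auto simp: u'_def Lead_def)
    moreover have "u' k = u k mod int (a k)"
      using w(2)[OF that(1)] by (simp add: u'_def minus_div_mult_eq_mod)
    moreover have "u k mod int (a k) > 0"
      using nd a1[OF that(1)] pos_mod_sign[of "int (a k)" "u k"] by (simp add: dvd_eq_mod_eq_0 less_le)
    ultimately have "Q k (nat (u k mod int (a k)))" by (auto simp: Q_def)
    then have "a k \<le> nat (u k mod int (a k))" unfolding a_def by (rule Least_le)
    moreover have "u k mod int (a k) < int (a k)" using a1[OF that(1)] by simp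
    ultimately show False using a1[OF that(1)] by arith
  qed
  have reduce: "\<exists>u'\<in>L. (\<forall>j\<ge>k. u' j = u j) \<and> (\<forall>j<k. 0 \<le> u' j \<and> u' j < int (a j))"
    if "u \<in> L" "k \<le> r" for u k
    using that
  proof (induction k arbitrary: u)
    case (Suc k)
    have k: "k < r" using Suc.prems by simp
    define u1 where "u1 = (\<lambda>j. u j - (u k div int (a k)) * w k j)"
    have "u1 \<in> L" unfolding u1_def by (rule step[OF Suc.prems(1) k])
    then obtain u' where u': "u' \<in> L" "\<And>j. j \<ge> k \<Longrightarrow> u' j = u1 j"
        "\<And>j. j < k \<Longrightarrow> 0 \<le> u' j \<and> u' j < int (a j)"
      using Suc.IH[of u1] k by auto
    have "u1 k = u k mod int (a k)" using w(2)[OF k] by (simp add: u1_def minus_div_mult_eq_mod)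
    moreover have "u1 j = u j" if "j > k" for j using w(1)[OF k] that by (simp add: u1_def Lead_def)
    ultimately show ?case using u' a1[OF k]
      by (intro bexI[of _ u']) (auto simp: less_Suc_eq)
  qed auto
  have "\<forall>i. \<exists>v. i < r \<longrightarrow> v \<in> L \<and> (\<forall>j\<ge>i. v j = w i j) \<and> (\<forall>j<i. 0 \<le> v j \<and> v j < int (a j))"
  proof
    fix i
    show "\<exists>v. i < r \<longrightarrow> v \<in> L \<and> (\<forall>j\<ge>i. v j = w i j) \<and> (\<forall>j<i. 0 \<le> v j \<and> v j < int (a j))"
      using reduce[of "w i" i] w(1)[of i] by (cases "i < r") (auto simp: Lead_def)
  qed
  then obtain v where v: "\<And>i. i < r \<Longrightarrow> v i \<in> L" "\<And>i j. i < r \<Longrightarrow> j \<ge> i \<Longrightarrow> v i j = w i j"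
      "\<And>i j. i < r \<Longrightarrow> j < i \<Longrightarrow> 0 \<le> v i j \<and> v i j < int (a j)"
    by metis
  have vi: "v i i = int (a i)" if "i < r" for i using v(2)[OF that, of i] w(2)[OF that] by simp
  have v0: "v i j = 0" if "i < r" "i < j" for i j
    using v(2)[OF that(1), of j] w(1)[OF that(1)] that(2) by (simp add: Lead_def)
  have gen: "\<exists>c. \<forall>j. u j = (\<Sum>i<k. c i * v i j)" if "u \<in> L" "\<forall>j\<ge>k. u j = 0" "k \<le> r" for u k
    using that
  proof (induction k arbitrary: u)
    case (Suc k)
    have k: "k < r" using Suc.prems by simp
    have "int (a k) dvd u k" using Suc.prems by (intro dvd k) (auto simp: Lead_def)
    then obtain d where d: "u k = int (a k) * d" by blast
    define u1 where "u1 = (\<lambda>j. u j - d * v k j)"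
    have "u1 \<in> L" unfolding u1_def using diff[OF Suc.prems(1) mult[OF v(1)[OF k]]] .
    moreover have "u1 j = 0" if "j \<ge> k" for j
      using that Suc.prems(2) d vi[OF k] v0[OF k, of j] by (cases "j = k") (auto simp: u1_def)
    ultimately obtain c where c: "\<And>j. u1 j = (\<Sum>i<k. c i * v i j)"
      using Suc.IH[of u1] k by auto
    have "u j = (\<Sum>i<Suc k. (c(k := d)) i * v i j)" for j
      using c[of j] by (simp add: u1_def)
    then show ?case by blast
  qed auto
  have "(\<Prod>j<r. a j) \<le> 2 * n"
  proof (rule ccontr)
    assume big: "\<not> (\<Prod>j<r. a j) \<le> 2 * n"
    \<comment> \<open>functions in this box agree outside r, where they are undefined, so their differences vanish there\<close>
    define X where "X = PiE {..<r} (\<lambda>j. {0..<int (a j)})"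
    have "card X = (\<Prod>j<r. a j)" by (simp add: X_def card_PiE)
    moreover have "finite X" by (auto simp: X_def intro: finite_PiE)
    ultimately obtain x y where xy: "x \<in> X" "y \<in> X" "x \<noteq> y" and L: "(\<lambda>j. x j - y j) \<in> L"
      using index[of X] big by auto
    define J where "J = {j. j < r \<and> x j \<noteq> y j}"
    have out: "x j = y j" if "\<not> j < r" for j
      using xy that by (auto simp: X_def PiE_def extensional_def)
    have J: "finite J" "J \<noteq> {}" using xy(3) out by (auto simp: J_def)
    \<comment> \<open>the difference of the two points has its leading coefficient, which is too small, at k\<close>
    define k where "k = Max J"
    have k: "k < r" "x k \<noteq> y k" using Max_in[OF J] by (auto simp: k_def J_def)
    have "x j = y j" if "j > k" for j
    proof (rule ccontr)
      assume "x j \<noteq> y j"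
      then have "j \<in> J" using out[of j] by (auto simp: J_def)
      then have "j \<le> k" unfolding k_def by (rule Max_ge[OF J(1)])
      with that show False by simp
    qed
    then have "int (a k) dvd x k - y k" using dvd[OF k(1), of "\<lambda>j. x j - y j"] L by (simp add: Lead_def)
    then have "\<bar>int (a k)\<bar> \<le> \<bar>x k - y k\<bar>" using k(2) by (intro dvd_imp_le_int) auto
    moreover have "x k \<in> {0..<int (a k)}" "y k \<in> {0..<int (a k)}"
      using PiE_mem[OF xy(1)[unfolded X_def], of k] PiE_mem[OF xy(2)[unfolded X_def], of k] k(1) by simp_all
    ultimately show False by simp arith
  qed
  then have sum: "(\<Sum>j<r. a j - 1) \<le> n" using a1 a_le by (intro sum_pred_le_of_prod_le) auto
  show thesis
  proof (rule that[of a v])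
    show "\<exists>c. \<forall>j. u j = (\<Sum>i<r. c i * v i j)" if "u \<in> L" "\<forall>j\<ge>r. u j = 0" for u
      using gen[OF that] by simp
  qed (use a1 v(1,3) vi v0 sum in auto)
qed


section \<open>Products of values with trivial weight\<close>

text \<open>
  The value of a Laurent monomial: the variables are the members of \<open>T\<close>, the value of the variable \<open>f\<close> is
  \<open>\<phi> f\<close>, and \<open>u\<close> is the vector of exponents.
\<close>

definition laurent_value :: "('f \<Rightarrow> 'k::field) \<Rightarrow> 'f list \<Rightarrow> (nat \<Rightarrow> int) \<Rightarrow> 'k" where
  "laurent_value \<phi> T u = (\<Prod>j<length T. \<phi> (T ! j) powi u j)"

lemma laurent_value_zero: "laurent_value \<phi> T (\<lambda>_. 0) = 1"
  by (simp add: laurent_value_def)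

lemma laurent_value_add:
  assumes "\<And>f. f \<in> set T \<Longrightarrow> \<phi> f \<noteq> 0"
  shows "laurent_value \<phi> T (\<lambda>j. u j + v j) = laurent_value \<phi> T u * laurent_value \<phi> T v"
  using assms by (simp add: laurent_value_def power_int_add flip: prod.distrib)

lemma laurent_value_diff:
  assumes "\<And>f. f \<in> set T \<Longrightarrow> \<phi> f \<noteq> 0"
  shows "laurent_value \<phi> T (\<lambda>j. u j - v j) = laurent_value \<phi> T u / laurent_value \<phi> T v"
  using assms by (simp add: laurent_value_def power_int_diff flip: prod_dividef)

lemma prod_power_int: "(\<Prod>j\<in>A. f j) powi c = (\<Prod>j\<in>A. f j powi c)" for f :: "'i \<Rightarrow> 'k::field"
  by (induction A rule: infinite_finite_induct) (auto simp: power_int_mult_distrib)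

lemma laurent_value_mult: "laurent_value \<phi> T (\<lambda>j. c * u j) = laurent_value \<phi> T u powi c"
  by (simp add: laurent_value_def power_int_mult mult.commute[of c] prod_power_int)

lemma laurent_value_combination:
  fixes k :: nat
  assumes nz: "\<And>f. f \<in> set T \<Longrightarrow> \<phi> f \<noteq> 0" and one: "\<And>i. i < k \<Longrightarrow> laurent_value \<phi> T (v i) = 1"
  shows "laurent_value \<phi> T (\<lambda>j. \<Sum>i<k. c i * v i j) = 1"
  using one
  by (induction k) (simp_all add: laurent_value_zero laurent_value_add[OF nz] laurent_value_mult)

lemma prod_lessThan_add:
  fixes f :: "nat \<Rightarrow> 'a::comm_monoid_mult" and p q :: nat
  shows "(\<Prod>j<p + q. f j) = (\<Prod>j<p. f j) * (\<Prod>j<q. f (p + j))"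
  by (induction q) (simp_all add: mult.assoc)

lemma laurent_value_append:
  "laurent_value \<phi> (A @ B) u = laurent_value \<phi> A u * laurent_value \<phi> B (\<lambda>j. u (length A + j))"
  by (simp add: laurent_value_def prod_lessThan_add nth_append)

lemma laurent_value_ones:
  assumes "\<And>j. j < length M \<Longrightarrow> u j = 1"
  shows "laurent_value \<phi> M u = (\<Prod>f\<leftarrow>M. \<phi> f)"
proof -
  have "(\<Prod>j<length M. \<phi> (M ! j)) = (\<Prod>f\<leftarrow>M. \<phi> f)"
    by (induction M rule: rev_induct) (simp_all add: nth_append)
  then show ?thesis using assms by (simp add: laurent_value_def)
qed

lemma laurent_value_zeros:
  assumes "\<And>j. j < length M \<Longrightarrow> u j = 0"
  shows "laurent_value \<phi> M u = 1"
  using assms by (simp add: laurent_value_def)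

text \<open>
  These two exponent vectors recover the ordinary products over two lists from a common set of variables.
\<close>

lemma laurent_value_prefix:
  "laurent_value \<phi> (A @ B) (\<lambda>j. if j < length A then 1 else 0) = (\<Prod>f\<leftarrow>A. \<phi> f)"
  by (simp add: laurent_value_append laurent_value_ones laurent_value_zeros)

lemma laurent_value_suffix:
  "laurent_value \<phi> (A @ B) (\<lambda>j. if length A \<le> j \<and> j < length (A @ B) then 1 else 0) = (\<Prod>f\<leftarrow>B. \<phi> f)"
  by (simp add: laurent_value_append laurent_value_ones laurent_value_zeros)

lemma prod_list_map_concat_upt:
  "(\<Prod>f\<leftarrow>concat (map g [0..<r]). \<phi> f) = (\<Prod>j<r. \<Prod>f\<leftarrow>g j. \<phi> f)"
  for \<phi> :: "'f \<Rightarrow> 'a::comm_monoid_mult"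
  by (induction r) simp_all

lemma length_concat_upt: "length (concat (map g [0..<r])) = (\<Sum>j<r. length (g j))"
  by (induction r) simp_all

lemma prod_list_map_zero_iff:
  "(\<Prod>f\<leftarrow>M. \<phi> f) = 0 \<longleftrightarrow> (\<exists>f\<in>set M. \<phi> f = 0)" for \<phi> :: "'f \<Rightarrow> 'k::field"
  by (induction M) auto

lemma prod_list_map_replicate: "(\<Prod>f\<leftarrow>replicate k f0. \<phi> f) = \<phi> f0 ^ k"
  for \<phi> :: "'f \<Rightarrow> 'k::comm_monoid_mult"
  by (induction k) auto

lemma finite_roots_of_unity_field: "finite {z::'k::field. z ^ k = 1}"
  and card_roots_of_unity_field: "card {z::'k::field. z ^ k = 1} \<le> k" if "k > 0"
proof -
  define p :: "'k poly" where "p = monom 1 k - 1"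
  have "coeff p k = 1" using that by (simp add: p_def)
  then have p: "p \<noteq> 0" by auto
  have "degree p \<le> k" unfolding p_def by (intro degree_diff_le) (auto simp: degree_monom_le)
  moreover have "{z. z ^ k = 1} = {z. poly p z = 0}" by (auto simp: p_def poly_monom)
  ultimately show "finite {z::'k. z ^ k = 1}" "card {z::'k. z ^ k = 1} \<le> k"
    using poly_roots_finite[OF p] card_poly_roots_bound[OF p] by auto
qed

text \<open>
  The combinatorial part of the upper bound. Here \<open>W\<close> is the set of weight functionals, \<open>\<alpha>\<close> and \<open>\<gamma>\<close> are the
  eigenvalues of \<open>a\<close> and \<open>c\<close>, \<open>dual\<close> is composition with \<open>b\<close>, and \<open>x, y, x', y'\<close> are the values at the
  points \<open>v\<close>, \<open>bv\<close>, \<open>w\<close>, \<open>bw\<close>.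
\<close>

locale weighted_values =
  fixes W :: "'f set" and dual :: "'f \<Rightarrow> 'f" and \<alpha> \<gamma> x y x' y' :: "'f \<Rightarrow> 'k::field" and n :: nat
  assumes n: "n \<ge> 2" "even n" and two: "(2::'k) \<noteq> 0"
    and weights: "f \<in> W \<Longrightarrow> \<alpha> f ^ n = 1" "f \<in> W \<Longrightarrow> \<gamma> f ^ 2 = 1"
    and dual_in: "f \<in> W \<Longrightarrow> dual f \<in> W"
    and dual_weights: "f \<in> W \<Longrightarrow> \<alpha> (dual f) = inverse (\<alpha> f)" "f \<in> W \<Longrightarrow> \<gamma> (dual f) = inverse (\<gamma> f)"
    and dual_values: "f \<in> W \<Longrightarrow> x (dual f) = y f" "f \<in> W \<Longrightarrow> y (dual f) = x f"
      "f \<in> W \<Longrightarrow> x' (dual f) = y' f" "f \<in> W \<Longrightarrow> y' (dual f) = x' f"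
    and agree: "\<lbrakk>set M \<subseteq> W; (\<Prod>f\<leftarrow>M. \<alpha> f) = 1; (\<Prod>f\<leftarrow>M. \<gamma> f) = 1; length M \<le> n + 2\<rbrakk> \<Longrightarrow>
      (\<Prod>f\<leftarrow>M. x f) + (\<Prod>f\<leftarrow>M. y f) = (\<Prod>f\<leftarrow>M. x' f) + (\<Prod>f\<leftarrow>M. y' f)"
begin

definition neutral :: "'f list \<Rightarrow> bool" where
  "neutral M \<longleftrightarrow> set M \<subseteq> W \<and> (\<Prod>f\<leftarrow>M. \<alpha> f) = 1 \<and> (\<Prod>f\<leftarrow>M. \<gamma> f) = 1"

definition relations :: "'f list \<Rightarrow> (nat \<Rightarrow> int) set" where
  "relations T = {u. laurent_value \<alpha> T u = 1 \<and> laurent_value \<gamma> T u = 1}"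

text \<open>
  A negative power of a variable is realised by a positive power of its dual, which has the inverse weight.
  So a relation of \<open>\<ell>\<^sub>1\<close>-norm \<open>d\<close> becomes a neutral list of length \<open>d\<close>.
\<close>

definition list_of :: "'f list \<Rightarrow> (nat \<Rightarrow> int) \<Rightarrow> 'f list" where
  "list_of T u = concat (map (\<lambda>j. replicate (nat (u j)) (T ! j) @ replicate (nat (- u j)) (dual (T ! j)))
     [0..<length T])"

lemma \<alpha>_nonzero: "f \<in> W \<Longrightarrow> \<alpha> f \<noteq> 0" and \<gamma>_nonzero: "f \<in> W \<Longrightarrow> \<gamma> f \<noteq> 0"
  using weights[of f] n by (auto simp: power_0_left)

lemma length_list_of: "length (list_of T u) = (\<Sum>j<length T. nat \<bar>u j\<bar>)"
  unfolding list_of_def length_concat_upt by (intro sum.cong) auto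

lemma prod_list_of:
  "(\<Prod>f\<leftarrow>list_of T u. \<phi> f) = (\<Prod>j<length T. \<phi> (T ! j) ^ nat (u j) * \<phi> (dual (T ! j)) ^ nat (- u j))"
  for \<phi> :: "'f \<Rightarrow> 'k"
  unfolding list_of_def prod_list_map_concat_upt by (simp add: prod_list_map_replicate)

lemma set_list_of: "set T \<subseteq> W \<Longrightarrow> set (list_of T u) \<subseteq> W"
  using dual_in by (auto simp: list_of_def subset_eq in_set_replicate)

lemma power_inverse_eq_powi: "z ^ nat k * inverse z ^ nat (- k) = z powi k" for z :: 'k
  by (auto simp: power_int_def)

lemma neutral_list_of:
  assumes T: "set T \<subseteq> W" and u: "u \<in> relations T"
  shows "neutral (list_of T u)"
proof -
  have "T ! j \<in> W" if "j < length T" for j using T that by auto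
  then have "(\<Prod>f\<leftarrow>list_of T u. \<alpha> f) = laurent_value \<alpha> T u" "(\<Prod>f\<leftarrow>list_of T u. \<gamma> f) = laurent_value \<gamma> T u"
    unfolding prod_list_of laurent_value_def
    by (auto intro!: prod.cong simp: dual_weights power_inverse_eq_powi)
  with u show ?thesis using set_list_of[OF T] by (simp add: neutral_def relations_def)
qed

lemma neutral_agree:
  "neutral M \<Longrightarrow> length M \<le> n + 2 \<Longrightarrow>
    (\<Prod>f\<leftarrow>M. x f) + (\<Prod>f\<leftarrow>M. y f) = (\<Prod>f\<leftarrow>M. x' f) + (\<Prod>f\<leftarrow>M. y' f)"
  by (simp add: neutral_def agree)

lemma product_agree: "x f * y f = x' f * y' f" if "f \<in> W"
proof -
  have "neutral [f, dual f]"
    using that dual_in \<alpha>_nonzero \<gamma>_nonzero by (simp add: neutral_def dual_weights)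
  from neutral_agree[OF this] have "2 * (x f * y f) = 2 * (x' f * y' f)"
    using n by (simp add: dual_values that algebra_simps)
  then show ?thesis using two by simp
qed

lemma power_agree: "x f ^ n + y f ^ n = x' f ^ n + y' f ^ n" if "f \<in> W"
proof -
  obtain m where m: "n = 2 * m" using n by auto
  have "\<gamma> f ^ n = 1" using weights(2)[OF that] by (simp add: m power_mult)
  then have "neutral (replicate n f)"
    using that n weights by (auto simp: neutral_def prod_list_map_replicate)
  from neutral_agree[OF this] show ?thesis by (simp add: prod_list_map_replicate)
qed

text \<open>
  Both \<open>x y\<close> and \<open>x\<^sup>n + y\<^sup>n\<close> are known, and together they vanish only for \<open>x = y = 0\<close>.
\<close>

lemma both_zero_iff: "x f = 0 \<and> y f = 0 \<longleftrightarrow> x' f = 0 \<and> y' f = 0" if "f \<in> W"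
proof -
  have n0: "n \<noteq> 0" using n by simp
  have *: "a = 0 \<and> b = 0" if "a * b = 0" "a ^ n + b ^ n = 0" for a b :: 'k
    using that n0 by (auto simp: power_0_left)
  show ?thesis
  proof
    assume "x f = 0 \<and> y f = 0"
    then show "x' f = 0 \<and> y' f = 0"
      using product_agree[OF that] power_agree[OF that] n0 by (intro *) (simp_all add: power_0_left)
  next
    assume "x' f = 0 \<and> y' f = 0"
    then show "x f = 0 \<and> y f = 0"
      using product_agree[OF that] power_agree[OF that] n0 by (intro *) (simp_all add: power_0_left)
  qed
qed

text \<open>
  The weights of the exponent vectors lie in \<open>\<mu>\<^sub>n \<times> \<mu>\<^sub>2\<close>, which has at most \<open>2 * n\<close> elements and exponent
  dividing \<open>n\<close> because \<open>n\<close> is even. The last conclusion says that the basis generates, in the form in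
  which it is used: a multiplicative function that is trivial on the basis is trivial on all relations.
\<close>

lemma relation_basis:
  assumes T: "set T \<subseteq> W"
  obtains a :: "nat \<Rightarrow> nat" and v :: "nat \<Rightarrow> nat \<Rightarrow> int"
  where "\<And>i. i < length T \<Longrightarrow> 1 \<le> a i" and "\<And>i. i < length T \<Longrightarrow> v i \<in> relations T"
    and "\<And>i. i < length T \<Longrightarrow> v i i = int (a i)" and "\<And>i j. i < length T \<Longrightarrow> i < j \<Longrightarrow> v i j = 0"
    and "\<And>i j. i < length T \<Longrightarrow> j < i \<Longrightarrow> 0 \<le> v i j \<and> v i j < int (a j)"
    and "(\<Sum>j<length T. a j - 1) \<le> n"
    and "\<And>\<phi> u. \<lbrakk>\<And>f. f \<in> set T \<Longrightarrow> \<phi> f \<noteq> 0; u \<in> relations T; \<forall>j\<ge>length T. u j = 0;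
      \<And>i. i < length T \<Longrightarrow> laurent_value \<phi> T (v i) = 1\<rbrakk> \<Longrightarrow> laurent_value \<phi> T u = (1::'k)"
proof -
  have nz: "\<alpha> f \<noteq> 0" "\<gamma> f \<noteq> 0" if "f \<in> set T" for f
    using T that \<alpha>_nonzero \<gamma>_nonzero by auto
  have n0: "n > 0" using n by simp
  define C :: "('k \<times> 'k) set" where "C = {z. z ^ n = 1} \<times> {z. z ^ 2 = 1}"
  have C: "finite C" "card C \<le> 2 * n"
  proof -
    show "finite C" unfolding C_def using n0 by (intro finite_cartesian_product finite_roots_of_unity_field) auto
    have "card C \<le> n * 2" unfolding C_def card_cartesian_product
      using n0 by (intro mult_mono card_roots_of_unity_field) auto
    then show "card C \<le> 2 * n" by simp
  qed
  have pow: "laurent_value \<phi> T u ^ k = 1" if "\<And>f. f \<in> set T \<Longrightarrow> \<phi> f ^ k = 1" for \<phi> :: "'f \<Rightarrow> 'k" and u k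
  proof -
    have "(\<phi> (T ! j) powi u j) ^ k = 1" if "j < length T" for j
    proof -
      have "(\<phi> (T ! j) powi u j) ^ k = (\<phi> (T ! j) ^ k) powi u j"
        by (simp add: power_int_power power_int_power' mult.commute)
      then show ?thesis using that \<open>\<And>f. f \<in> set T \<Longrightarrow> \<phi> f ^ k = 1\<close> by simp
    qed
    then show ?thesis by (simp add: laurent_value_def prod_power_distrib)
  qed
  show thesis
  proof (rule reduced_lattice_basis[where L = "relations T" and n = n and r = "length T"])
    show "(\<lambda>_. 0) \<in> relations T" by (simp add: relations_def laurent_value_zero)
    show "(\<lambda>j. u j - v j) \<in> relations T" if "u \<in> relations T" "v \<in> relations T" for u v
      using that nz by (simp add: relations_def laurent_value_diff)
    show "n > 0" by (fact n0)
    show "(\<lambda>i. if i = j then int n else 0) \<in> relations T" if "j < length T" for j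
    proof -
      have *: "laurent_value \<phi> T (\<lambda>i. if i = j then int n else 0) = \<phi> (T ! j) ^ n" for \<phi> :: "'f \<Rightarrow> 'k"
        unfolding laurent_value_def using that
        by (simp add: if_distrib[of "\<lambda>k. _ powi k"] prod.delta cong: if_cong)
      have "T ! j \<in> W" using T that by auto
      then have "\<alpha> (T ! j) ^ n = 1" "\<gamma> (T ! j) ^ n = 1"
        using weights[of "T ! j"] n by (auto elim!: evenE simp: power_mult)
      then show ?thesis by (simp add: relations_def *)
    qed
    show "\<exists>p\<in>X. \<exists>q\<in>X. p \<noteq> q \<and> (\<lambda>j. p j - q j) \<in> relations T"
      if X: "finite X" "card X > 2 * n" for X
    proof -
      let ?h = "\<lambda>u. (laurent_value \<alpha> T u, laurent_value \<gamma> T u)"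
      have "?h ` X \<subseteq> C" using weights T by (auto simp: C_def intro!: pow)
      then have "card (?h ` X) \<le> 2 * n" using card_mono[OF C(1)] C(2) by (meson le_trans)
      then have "\<not> inj_on ?h X" using X(2) card_image by fastforce
      then obtain p q where "p \<in> X" "q \<in> X" "p \<noteq> q" "?h p = ?h q" by (auto simp: inj_on_def)
      moreover have "laurent_value \<phi> T q \<noteq> 0" if "\<And>f. f \<in> set T \<Longrightarrow> \<phi> f \<noteq> 0" for \<phi> :: "'f \<Rightarrow> 'k"
        using that by (auto simp: laurent_value_def)
      ultimately show ?thesis using nz by (auto simp: relations_def laurent_value_diff)
    qed
  next
    fix a v
    assume *: "\<And>i. i < length T \<Longrightarrow> 1 \<le> a i" "\<And>i. i < length T \<Longrightarrow> v i \<in> relations T"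
      "\<And>i. i < length T \<Longrightarrow> v i i = int (a i)" "\<And>i j. i < length T \<Longrightarrow> i < j \<Longrightarrow> v i j = 0"
      "\<And>i j. i < length T \<Longrightarrow> j < i \<Longrightarrow> 0 \<le> v i j \<and> v i j < int (a j)"
      "(\<Sum>j<length T. a j - 1) \<le> n"
      and gen: "\<And>u. u \<in> relations T \<Longrightarrow> \<forall>j\<ge>length T. u j = 0 \<Longrightarrow> \<exists>c. \<forall>j. u j = (\<Sum>i<length T. c i * v i j)"
    show thesis
    proof (rule that[of a v, OF *])
      fix \<phi> :: "'f \<Rightarrow> 'k" and u
      assume \<phi>: "\<And>f. f \<in> set T \<Longrightarrow> \<phi> f \<noteq> 0" and u: "u \<in> relations T" "\<forall>j\<ge>length T. u j = 0"
        and one: "\<And>i. i < length T \<Longrightarrow> laurent_value \<phi> T (v i) = 1"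
      obtain c where "\<forall>j. u j = (\<Sum>i<length T. c i * v i j)" using gen[OF u] by blast
      then have "u = (\<lambda>j. \<Sum>i<length T. c i * v i j)" by auto
      with laurent_value_combination[of T \<phi> "length T" v c] \<phi> one show "laurent_value \<phi> T u = 1" by simp
    qed
  qed
qed

lemma one_sided_agree:
  assumes l: "l \<in> W" "y l = 0" "y' l = 0" and M: "neutral M" "length M \<le> n + 2" "l \<in> set M"
  shows "(\<Prod>f\<leftarrow>M. x f) = (\<Prod>f\<leftarrow>M. x' f)"
proof -
  have "(\<Prod>f\<leftarrow>M. y f) = 0" "(\<Prod>f\<leftarrow>M. y' f) = 0"
    using l M(3) by (auto simp: prod_list_map_zero_iff)
  with neutral_agree[OF M(1,2)] show ?thesis by simp
qed

text \<open>
  The one-sided case needs relations that involve the first variable and have no negative exponents. The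
  basis vectors have nonnegative entries, and where the first entry is missing the basis vector \<open>v 0\<close>, a
  power of the first variable, is added. This costs at most 1 more than \<open>\<Sum>(a\<^sub>j - 1) + 1\<close> in length.
\<close>

lemma relations_through:
  assumes T: "set T \<subseteq> W" and ne: "T \<noteq> []"
  obtains w :: "nat \<Rightarrow> nat \<Rightarrow> int"
  where "\<And>i. i < length T \<Longrightarrow> w i \<in> relations T" and "\<And>i j. i < length T \<Longrightarrow> 0 \<le> w i j"
    and "\<And>i. i < length T \<Longrightarrow> 1 \<le> w i 0" and "\<And>i. i < length T \<Longrightarrow> 1 \<le> w i i"
    and "\<And>i. i < length T \<Longrightarrow> (\<Sum>j<length T. nat \<bar>w i j\<bar>) \<le> n + 2"
    and "\<And>\<phi> u. \<lbrakk>\<And>f. f \<in> set T \<Longrightarrow> \<phi> f \<noteq> 0; u \<in> relations T; \<forall>j\<ge>length T. u j = 0;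
      \<And>i. i < length T \<Longrightarrow> laurent_value \<phi> T (w i) = 1\<rbrakk> \<Longrightarrow> laurent_value \<phi> T u = (1::'k)"
proof -
  let ?r = "length T"
  have nz: "\<alpha> f \<noteq> 0" "\<gamma> f \<noteq> 0" if "f \<in> set T" for f
    using T that \<alpha>_nonzero \<gamma>_nonzero by auto
  have r: "0 < ?r" using ne by simp
  show ?thesis
  proof (rule relation_basis[OF T])
    fix a v
    assume a: "\<And>i. i < ?r \<Longrightarrow> 1 \<le> a i" and v: "\<And>i. i < ?r \<Longrightarrow> v i \<in> relations T"
      and vi: "\<And>i. i < ?r \<Longrightarrow> v i i = int (a i)" and v0: "\<And>i j. i < ?r \<Longrightarrow> i < j \<Longrightarrow> v i j = 0"
      and vj: "\<And>i j. i < ?r \<Longrightarrow> j < i \<Longrightarrow> 0 \<le> v i j \<and> v i j < int (a j)"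
      and sum: "(\<Sum>j<?r. a j - 1) \<le> n"
      and gen: "\<And>\<phi> u. \<lbrakk>\<And>f. f \<in> set T \<Longrightarrow> \<phi> f \<noteq> 0; u \<in> relations T; \<forall>j\<ge>length T. u j = 0;
        \<And>i. i < length T \<Longrightarrow> laurent_value \<phi> T (v i) = 1\<rbrakk> \<Longrightarrow> laurent_value \<phi> T u = (1::'k)"
    define w where "w i = (if v i 0 = 0 then (\<lambda>j. v i j + v 0 j) else v i)" for i
    have nonneg: "0 \<le> v i j" if "i < ?r" for i j
      using vi[OF that] v0[OF that, of j] vj[OF that, of j] by (cases i j rule: linorder_cases) auto
    have v00: "v 0 0 = int (a 0)" "1 \<le> a 0" using vi[OF r] a[OF r] by auto
    have bound: "nat \<bar>w i j\<bar> \<le> (a j - 1) + (if j = 0 then 1 else 0) + (if j = i then 1 else 0)" if "i < ?r" "j < ?r" for i j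
      using vi[OF that(1)] v0[OF that(1), of j] vj[OF that(1), of j] v0[OF r, of j] v00 a[OF that(1)] nonneg[OF that(1), of j]
        a[OF that(2)]
      by (cases i j rule: linorder_cases) (auto simp: w_def)
    show thesis
    proof (rule that[of w])
      fix i assume i: "i < ?r"
      show "w i \<in> relations T"
        using v[OF i] v[OF r] nz by (auto simp: w_def relations_def laurent_value_add)
      show "0 \<le> w i j" for j using nonneg[OF i, of j] nonneg[OF r, of j] by (auto simp: w_def)
      show "1 \<le> w i 0" using nonneg[OF i, of 0] v00 by (auto simp: w_def)
      show "1 \<le> w i i" using vi[OF i] a[OF i] nonneg[OF r, of i] by (auto simp: w_def)
      have "(\<Sum>j<?r. nat \<bar>w i j\<bar>) \<le> (\<Sum>j<?r. (a j - 1) + (if j = 0 then 1 else 0) + (if j = i then 1 else 0))"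
        using bound[OF i] by (intro sum_mono) auto
      also have "\<dots> = (\<Sum>j<?r. a j - 1) + 2"
        using i r by (simp add: sum.distrib)
      finally show "(\<Sum>j<?r. nat \<bar>w i j\<bar>) \<le> n + 2" using sum by simp
    next
      fix \<phi> :: "'f \<Rightarrow> 'k" and u
      assume \<phi>: "\<And>f. f \<in> set T \<Longrightarrow> \<phi> f \<noteq> 0" and u: "u \<in> relations T" "\<forall>j\<ge>length T. u j = 0"
        and one: "\<And>i. i < length T \<Longrightarrow> laurent_value \<phi> T (w i) = 1"
      have w0: "laurent_value \<phi> T (v 0) = 1" using one[OF r] v00 by (simp add: w_def)
      have "laurent_value \<phi> T (v i) = 1" if "i < ?r" for i
        using one[OF that] w0 by (auto simp: w_def laurent_value_add[OF \<phi>] split: if_splits)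
      then show "laurent_value \<phi> T u = 1" by (intro gen[of \<phi> u]) (use \<phi> u in auto)
    qed
  qed
qed

text \<open>
  Lists through \<open>l\<close> have \<open>y(M) = y'(M) = 0\<close>, so the short ones satisfy \<open>x(M) = x'(M)\<close>. Applied to the
  variables \<open>l\<close> and \<open>f\<close> this shows that \<open>x f\<close> and \<open>x' f\<close> vanish simultaneously; applied to \<open>l\<close> and the
  members of \<open>M\<close> it shows that \<open>x'/x\<close> is trivial on generators of the relations.
\<close>

lemma one_sided_case:
  assumes l: "l \<in> W" "x l \<noteq> 0" "y l = 0" "x' l \<noteq> 0" "y' l = 0" and M: "neutral M"
  shows "(\<Prod>f\<leftarrow>M. x f) = (\<Prod>f\<leftarrow>M. x' f)"
proof -
  have agree_w: "(\<Prod>j<length T. x (T ! j) ^ nat (w j)) = (\<Prod>j<length T. x' (T ! j) ^ nat (w j))"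
    if T: "set T \<subseteq> W" "T \<noteq> []" "T ! 0 = l" and w: "w \<in> relations T" "\<And>j. 0 \<le> w j" "1 \<le> w 0"
      "(\<Sum>j<length T. nat \<bar>w j\<bar>) \<le> n + 2" for T and w :: "nat \<Rightarrow> int"
  proof -
    have "l \<in> set (list_of T w)"
      using T w(3) by (auto simp: list_of_def intro!: bexI[of _ 0])
    then have "(\<Prod>f\<leftarrow>list_of T w. x f) = (\<Prod>f\<leftarrow>list_of T w. x' f)"
      using l T w neutral_list_of by (intro one_sided_agree[of l]) (auto simp: length_list_of)
    then show ?thesis using w(2) by (simp add: prod_list_of)
  qed
  have support: "x f = 0 \<longleftrightarrow> x' f = 0" if "f \<in> W" for f
  proof -
    have T: "set [l, f] \<subseteq> W" "[l, f] \<noteq> []" using that l by auto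
    show ?thesis
    proof (rule relations_through[OF T])
      fix w :: "nat \<Rightarrow> nat \<Rightarrow> int"
      assume "\<And>i. i < length [l, f] \<Longrightarrow> w i \<in> relations [l, f]" "\<And>i j. i < length [l, f] \<Longrightarrow> 0 \<le> w i j"
        "\<And>i. i < length [l, f] \<Longrightarrow> 1 \<le> w i 0" "\<And>i. i < length [l, f] \<Longrightarrow> 1 \<le> w i i"
        "\<And>i. i < length [l, f] \<Longrightarrow> (\<Sum>j<length [l, f]. nat \<bar>w i j\<bar>) \<le> n + 2"
      note w = this[of 1]
      have "x l ^ nat (w 1 0) * x f ^ nat (w 1 1) = x' l ^ nat (w 1 0) * x' f ^ nat (w 1 1)"
        using agree_w[OF T, of "w 1"] w by (simp add: lessThan_Suc numeral_2_eq_2 mult.commute)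
      then show ?thesis using l w(4) by (auto simp: power_0_left)
    qed
  qed
  show ?thesis
  proof (cases "\<exists>f\<in>set M. x f = 0")
    case True
    then have "(\<Prod>f\<leftarrow>M. x f) = 0" "(\<Prod>f\<leftarrow>M. x' f) = 0"
      using support M by (auto simp: prod_list_map_zero_iff neutral_def)
    then show ?thesis by simp
  next
    case False
    define T where "T = [l] @ M"
    define \<phi> where "\<phi> f = x' f / x f" for f
    define u :: "nat \<Rightarrow> int" where "u = (\<lambda>j. if length [l] \<le> j \<and> j < length ([l] @ M) then 1 else 0)"
    have T: "set T \<subseteq> W" "T \<noteq> []" "T ! 0 = l" using l M by (auto simp: T_def neutral_def)
    have nz: "x f \<noteq> 0" "x' f \<noteq> 0" if "f \<in> set T" for f
      using that False support l M by (auto simp: T_def neutral_def)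
    have \<phi>: "\<phi> f \<noteq> 0" if "f \<in> set T" for f using nz[OF that] by (simp add: \<phi>_def)
    have u: "laurent_value \<psi> T u = (\<Prod>f\<leftarrow>M. \<psi> f)" for \<psi> :: "'f \<Rightarrow> 'k"
      unfolding T_def u_def by (rule laurent_value_suffix)
    show ?thesis
    proof (rule relations_through[OF T(1,2)])
      fix w :: "nat \<Rightarrow> nat \<Rightarrow> int"
      assume w: "\<And>i. i < length T \<Longrightarrow> w i \<in> relations T" "\<And>i j. i < length T \<Longrightarrow> 0 \<le> w i j"
        "\<And>i. i < length T \<Longrightarrow> 1 \<le> w i 0" "\<And>i. i < length T \<Longrightarrow> (\<Sum>j<length T. nat \<bar>w i j\<bar>) \<le> n + 2"
        and gen: "\<And>\<phi> u. \<lbrakk>\<And>f. f \<in> set T \<Longrightarrow> \<phi> f \<noteq> 0; u \<in> relations T; \<forall>j\<ge>length T. u j = 0;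
          \<And>i. i < length T \<Longrightarrow> laurent_value \<phi> T (w i) = 1\<rbrakk> \<Longrightarrow> laurent_value \<phi> T u = (1::'k)"
      have "laurent_value \<phi> T u = 1"
      proof (rule gen)
        show "u \<in> relations T" using M by (simp add: relations_def u neutral_def)
        show "\<forall>j\<ge>length T. u j = 0" by (simp add: u_def T_def)
        fix i assume i: "i < length T"
        have "laurent_value \<phi> T (w i) =
            (\<Prod>j<length T. x' (T ! j) ^ nat (w i j)) / (\<Prod>j<length T. x (T ! j) ^ nat (w i j))"
          using w(2)[OF i] by (simp add: laurent_value_def \<phi>_def power_int_def power_divide prod_dividef)
        also have "\<dots> = 1"
          using agree_w[OF T w(1)[OF i] w(2)[OF i] w(3)[OF i] w(4)[OF i]] nz by simp
        finally show "laurent_value \<phi> T (w i) = 1" .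
      qed (use \<phi> in auto)
      moreover have "laurent_value \<phi> T u = (\<Prod>f\<leftarrow>M. x' f) / (\<Prod>f\<leftarrow>M. x f)"
        unfolding u by (induction M) (auto simp: \<phi>_def)
      moreover have "(\<Prod>f\<leftarrow>M. x f) \<noteq> 0" using False by (auto simp: prod_list_map_zero_iff)
      ultimately show ?thesis by simp
    qed
  qed
qed

text \<open>
  With \<open>R\<close> the value of the relation under \<open>x'/x\<close>, the identity \<open>x y = x' y'\<close> gives \<open>X' = X R\<close> and
  \<open>Y' = Y / R\<close> for the four products. Then \<open>X + Y = X' + Y'\<close> reads \<open>(R - 1) (R X - Y) = 0\<close>, and \<open>R X / Y\<close>
  is the value of the relation under \<open>x'/y\<close>.
\<close>

lemma short_relation:
  assumes T: "set T \<subseteq> W" and nz: "\<And>f. f \<in> set T \<Longrightarrow> x f \<noteq> 0 \<and> y f \<noteq> 0"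
    and u: "u \<in> relations T" "(\<Sum>j<length T. nat \<bar>u j\<bar>) \<le> n + 2"
  shows "laurent_value (\<lambda>f. x' f / x f) T u = 1 \<or> laurent_value (\<lambda>f. x' f / y f) T u = 1"
proof -
  define X Y where "X = (\<Prod>f\<leftarrow>list_of T u. x f)" and "Y = (\<Prod>f\<leftarrow>list_of T u. y f)"
  have Tj: "T ! j \<in> W" "x (T ! j) \<noteq> 0" "y (T ! j) \<noteq> 0" "x' (T ! j) \<noteq> 0" "y' (T ! j) = x (T ! j) * y (T ! j) / x' (T ! j)"
    if "j < length T" for j
  proof -
    have f: "T ! j \<in> set T" using that by simp
    then show "T ! j \<in> W" "x (T ! j) \<noteq> 0" "y (T ! j) \<noteq> 0" using T nz by auto
    with product_agree[of "T ! j"]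
    show "x' (T ! j) \<noteq> 0" "y' (T ! j) = x (T ! j) * y (T ! j) / x' (T ! j)"
      by (auto simp: field_simps)
  qed
  have val_list: "(\<Prod>f\<leftarrow>list_of T u. \<phi> f) = (\<Prod>j<length T. \<phi> (T ! j) ^ nat (u j) * \<psi> (T ! j) ^ nat (- u j))"
    if "\<And>f. f \<in> W \<Longrightarrow> \<phi> (dual f) = \<psi> f" for \<phi> \<psi> :: "'f \<Rightarrow> 'k"
    unfolding prod_list_of using Tj(1) that by (intro prod.cong) auto
  let ?P = "\<lambda>\<phi> \<psi>. \<Prod>j<length T. \<phi> (T ! j) ^ nat (u j) * \<psi> (T ! j) ^ nat (- u j)"
  have v1: "(\<Prod>f\<leftarrow>list_of T u. x f) = ?P x y" by (rule val_list) (rule dual_values(1))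
  have v2: "(\<Prod>f\<leftarrow>list_of T u. y f) = ?P y x" by (rule val_list) (rule dual_values(2))
  have v3: "(\<Prod>f\<leftarrow>list_of T u. x' f) = ?P x' y'" by (rule val_list) (rule dual_values(3))
  have v4: "(\<Prod>f\<leftarrow>list_of T u. y' f) = ?P y' x'" by (rule val_list) (rule dual_values(4))
  define R S where "R = laurent_value (\<lambda>f. x' f / x f) T u" and "S = laurent_value (\<lambda>f. x' f / y f) T u"
  have X: "X \<noteq> 0" and Y: "Y \<noteq> 0" and R: "R \<noteq> 0"
    unfolding X_def Y_def R_def v1 v2 laurent_value_def
    using Tj by auto
  have X': "(\<Prod>f\<leftarrow>list_of T u. x' f) = X * R"
    unfolding X_def v1 v3 R_def laurent_value_def prod.distrib[symmetric]
  proof (rule prod.cong[OF refl])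
    fix j assume "j \<in> {..<length T}"
    then have j: "j < length T" by simp
    show "x' (T ! j) ^ nat (u j) * y' (T ! j) ^ nat (- u j) =
        x (T ! j) ^ nat (u j) * y (T ! j) ^ nat (- u j) * (x' (T ! j) / x (T ! j)) powi u j"
      unfolding Tj(5)[OF j] using Tj(2,3,4)[OF j]
      by (cases "u j \<ge> 0") (simp_all add: power_int_def power_divide power_mult_distrib field_simps)
  qed
  have Y': "(\<Prod>f\<leftarrow>list_of T u. y' f) = Y / R"
    unfolding Y_def v2 v4 R_def laurent_value_def prod_dividef[symmetric]
  proof (rule prod.cong[OF refl])
    fix j assume "j \<in> {..<length T}"
    then have j: "j < length T" by simp
    show "y' (T ! j) ^ nat (u j) * x' (T ! j) ^ nat (- u j) =
        y (T ! j) ^ nat (u j) * x (T ! j) ^ nat (- u j) / (x' (T ! j) / x (T ! j)) powi u j"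
      unfolding Tj(5)[OF j] using Tj(2,3,4)[OF j]
      by (cases "u j \<ge> 0") (simp_all add: power_int_def power_divide power_mult_distrib field_simps)
  qed
  have S: "S * Y = R * X"
    unfolding Y_def X_def v1 v2 R_def S_def laurent_value_def prod.distrib[symmetric]
  proof (rule prod.cong[OF refl])
    fix j assume "j \<in> {..<length T}"
    then have j: "j < length T" by simp
    show "(x' (T ! j) / y (T ! j)) powi u j * (y (T ! j) ^ nat (u j) * x (T ! j) ^ nat (- u j)) =
        (x' (T ! j) / x (T ! j)) powi u j * (x (T ! j) ^ nat (u j) * y (T ! j) ^ nat (- u j))"
      unfolding Tj(5)[OF j] using Tj(2,3,4)[OF j]
      by (cases "u j \<ge> 0") (simp_all add: power_int_def power_divide power_mult_distrib field_simps)
  qed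
  have "X + Y = X * R + Y / R"
    using neutral_agree[OF neutral_list_of[OF T u(1)]] u(2) by (simp add: length_list_of X' Y' X_def Y_def)
  then have "(R - 1) * (R * X - Y) = 0" using R by (simp add: field_simps)
  then have "R = 1 \<or> S * Y = Y" using S by auto
  then show ?thesis using Y by (auto simp: R_def S_def)
qed

text \<open>
  A vector of the form \<open>v k - v i\<close> has entries of absolute value at most \<open>a j - 1\<close>, except for one more at
  each of the positions \<open>i\<close> and \<open>k\<close>. It is therefore short, as are \<open>v i\<close> and \<open>v k\<close> themselves. If \<open>v i\<close>
  is nontrivial under \<open>x'/x\<close> and \<open>v k\<close> under \<open>x'/y\<close>, each is trivial under the other homomorphism by
  \<open>short_relation\<close>, so that the difference is nontrivial under both, which contradicts the same lemma.
\<close>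

lemma two_sided_case:
  assumes zero: "\<And>f. f \<in> W \<Longrightarrow> x f = 0 \<longleftrightarrow> y f = 0"
    and M1: "neutral M1" and M2: "neutral M2"
  shows "(\<Prod>f\<leftarrow>M1. x f) = (\<Prod>f\<leftarrow>M1. x' f) \<or> (\<Prod>f\<leftarrow>M2. y f) = (\<Prod>f\<leftarrow>M2. x' f)"
proof (rule ccontr)
  assume neg: "\<not> ?thesis"
  define T where "T = M1 @ M2"
  let ?r = "length T"
  have T: "set T \<subseteq> W" using M1 M2 by (simp add: T_def neutral_def)
  have x'0: "x' f = 0" if "f \<in> W" "x f = 0" for f
    using both_zero_iff[OF that(1)] zero[OF that(1)] that(2) by simp
  have nz: "x f \<noteq> 0 \<and> y f \<noteq> 0" if f: "f \<in> set T" for f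
  proof (rule ccontr)
    assume "\<not> (x f \<noteq> 0 \<and> y f \<noteq> 0)"
    then have "x f = 0" "y f = 0" "x' f = 0" using zero[of f] x'0[of f] T f by auto
    then have "(\<Prod>f\<leftarrow>M. x f) = 0 \<and> (\<Prod>f\<leftarrow>M. y f) = 0 \<and> (\<Prod>f\<leftarrow>M. x' f) = 0" if "f \<in> set M" for M
      using that by (auto simp: prod_list_map_zero_iff)
    then show False using neg f by (auto simp: T_def)
  qed
  have nz': "x' f \<noteq> 0" if "f \<in> set T" for f
    using product_agree[of f] nz[OF that] T that by auto
  define \<phi> \<psi> where "\<phi> f = x' f / x f" and "\<psi> f = x' f / y f" for f
  have \<phi>: "\<phi> f \<noteq> 0" and \<psi>: "\<psi> f \<noteq> 0" if "f \<in> set T" for f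
    using nz[OF that] nz'[OF that] by (simp_all add: \<phi>_def \<psi>_def)
  show False
  proof (rule relation_basis[OF T])
    fix a v
    assume a: "\<And>i. i < ?r \<Longrightarrow> 1 \<le> a i" and v: "\<And>i. i < ?r \<Longrightarrow> v i \<in> relations T"
      and vi: "\<And>i. i < ?r \<Longrightarrow> v i i = int (a i)" and v0: "\<And>i j. i < ?r \<Longrightarrow> i < j \<Longrightarrow> v i j = 0"
      and vj: "\<And>i j. i < ?r \<Longrightarrow> j < i \<Longrightarrow> 0 \<le> v i j \<and> v i j < int (a j)"
      and sum: "(\<Sum>j<?r. a j - 1) \<le> n"
      and gen: "\<And>\<phi> u. \<lbrakk>\<And>f. f \<in> set T \<Longrightarrow> \<phi> f \<noteq> 0; u \<in> relations T; \<forall>j\<ge>length T. u j = 0;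
        \<And>i. i < length T \<Longrightarrow> laurent_value \<phi> T (v i) = 1\<rbrakk> \<Longrightarrow> laurent_value \<phi> T u = (1::'k)"
    have "\<exists>i<?r. laurent_value \<phi> T (v i) \<noteq> 1"
    proof (rule ccontr)
      let ?u = "\<lambda>j. if j < length M1 then 1 else 0"
      assume all: "\<not> ?thesis"
      have "?u \<in> relations T"
        using M1 by (simp add: relations_def neutral_def T_def laurent_value_prefix)
      then have "laurent_value \<phi> T ?u = 1"
        by (intro gen[of \<phi> ?u]) (use all \<phi> in \<open>auto simp: T_def\<close>)
      then have "(\<Prod>f\<leftarrow>M1. \<phi> f) = 1" by (simp add: T_def laurent_value_prefix)
      moreover have "(\<Prod>f\<leftarrow>M1. \<phi> f) = (\<Prod>f\<leftarrow>M1. x' f) / (\<Prod>f\<leftarrow>M1. x f)"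
        by (induction M1) (auto simp: \<phi>_def)
      moreover have "(\<Prod>f\<leftarrow>M1. x f) \<noteq> 0" using nz by (auto simp: T_def prod_list_map_zero_iff)
      ultimately show False using neg by auto
    qed
    then obtain i where i: "i < ?r" "laurent_value \<phi> T (v i) \<noteq> 1" by blast
    have "\<exists>k<?r. laurent_value \<psi> T (v k) \<noteq> 1"
    proof (rule ccontr)
      let ?u = "\<lambda>j. if length M1 \<le> j \<and> j < length (M1 @ M2) then 1 else 0"
      assume all: "\<not> ?thesis"
      have u: "laurent_value \<theta> T ?u = (\<Prod>f\<leftarrow>M2. \<theta> f)" for \<theta> :: "'f \<Rightarrow> 'k"
        unfolding T_def by (rule laurent_value_suffix)
      have "?u \<in> relations T"
        using M2 unfolding relations_def neutral_def by (simp only: u mem_Collect_eq)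
      then have "laurent_value \<psi> T ?u = 1"
        by (intro gen[of \<psi> ?u]) (use all \<psi> in \<open>auto simp: T_def\<close>)
      then have "(\<Prod>f\<leftarrow>M2. \<psi> f) = 1" by (simp only: u)
      moreover have "(\<Prod>f\<leftarrow>M2. \<psi> f) = (\<Prod>f\<leftarrow>M2. x' f) / (\<Prod>f\<leftarrow>M2. y f)"
        by (induction M2) (auto simp: \<psi>_def)
      moreover have "(\<Prod>f\<leftarrow>M2. y f) \<noteq> 0" using nz by (auto simp: T_def prod_list_map_zero_iff)
      ultimately show False using neg by auto
    qed
    then obtain k where k: "k < ?r" "laurent_value \<psi> T (v k) \<noteq> 1" by blast
    have short: "laurent_value \<phi> T u = 1 \<or> laurent_value \<psi> T u = 1"
      if "u \<in> relations T" "\<And>j. j < ?r \<Longrightarrow> nat \<bar>u j\<bar> \<le> (a j - 1) + (if j = i then 1 else 0) + (if j = k then 1 else 0)" for u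
    proof -
      have "(\<Sum>j<?r. nat \<bar>u j\<bar>) \<le> (\<Sum>j<?r. (a j - 1) + (if j = i then 1 else 0) + (if j = k then 1 else 0))"
        using that(2) by (intro sum_mono) auto
      also have "\<dots> = (\<Sum>j<?r. a j - 1) + 2" using i k by (simp add: sum.distrib)
      finally show ?thesis
        using short_relation[OF T nz that(1)] sum by (simp add: \<phi>_def[abs_def] \<psi>_def[abs_def])
    qed
    have range: "0 \<le> v i j \<and> v i j \<le> int (a j) - (if j = i then 0 else 1)" if "i < ?r" "j < ?r" for i j
      using vi[OF that(1)] v0[OF that(1), of j] vj[OF that(1), of j] a[OF that(2)]
      by (cases i j rule: linorder_cases) auto
    have \<psi>i: "laurent_value \<psi> T (v i) = 1"
      using short[OF v[OF i(1)]] i range[OF i(1)] a by fastforce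
    have \<phi>k: "laurent_value \<phi> T (v k) = 1"
      using short[OF v[OF k(1)]] k range[OF k(1)] a by fastforce
    have "(\<lambda>j. v k j - v i j) \<in> relations T"
      using v[OF i(1)] v[OF k(1)] T \<alpha>_nonzero \<gamma>_nonzero by (auto simp: relations_def laurent_value_diff subset_eq)
    moreover have "nat \<bar>v k j - v i j\<bar> \<le> (a j - 1) + (if j = i then 1 else 0) + (if j = k then 1 else 0)" if "j < ?r" for j
      using range[OF i(1) that] range[OF k(1) that] a[OF that] by (auto split: if_splits)
    ultimately have "laurent_value \<phi> T (\<lambda>j. v k j - v i j) = 1 \<or> laurent_value \<psi> T (\<lambda>j. v k j - v i j) = 1"
      by (rule short)
    then show False
      using i(2) k(2) \<psi>i \<phi>k by (auto simp: laurent_value_diff[OF \<phi>] laurent_value_diff[OF \<psi>])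
  qed
qed

lemma swap_target: "weighted_values W dual \<alpha> \<gamma> x y y' x' n"
  by unfold_locales (use n two weights dual_in dual_weights dual_values agree in \<open>auto simp: add.commute\<close>)

lemma neutral_dual:
  assumes "neutral M"
  shows "neutral (map dual M)"
proof -
  have "(\<Prod>f\<leftarrow>map dual M. \<alpha> f) = inverse (\<Prod>f\<leftarrow>M. \<alpha> f)" "(\<Prod>f\<leftarrow>map dual M. \<gamma> f) = inverse (\<Prod>f\<leftarrow>M. \<gamma> f)"
    if "set M \<subseteq> W" using that by (induction M) (auto simp: dual_weights)
  with assms dual_in show ?thesis by (auto simp: neutral_def)
qed

text \<open>
  In the one-sided case the functional \<open>l\<close> also has exactly one of \<open>x' l\<close>, \<open>y' l\<close> nonzero. If it is
  \<open>y' l\<close>, the previous results apply with the roles of \<open>w\<close> and \<open>bw\<close> exchanged; passing to the dual lists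
  then gives the second alternative.
\<close>

lemma neutral_products_agree:
  "(\<forall>M. neutral M \<longrightarrow> (\<Prod>f\<leftarrow>M. x f) = (\<Prod>f\<leftarrow>M. x' f)) \<or>
   (\<forall>M. neutral M \<longrightarrow> (\<Prod>f\<leftarrow>M. y f) = (\<Prod>f\<leftarrow>M. x' f))"
proof (cases "\<forall>f\<in>W. x f = 0 \<longleftrightarrow> y f = 0")
  case True
  then show ?thesis using two_sided_case by blast
next
  case False
  then obtain f where f: "f \<in> W" "(x f = 0) \<noteq> (y f = 0)" by blast
  define l where "l = (if x f = 0 then dual f else f)"
  have l: "l \<in> W" "x l \<noteq> 0" "y l = 0"
    using f dual_in by (auto simp: l_def dual_values)
  have l': "x' l * y' l = 0" "x' l \<noteq> 0 \<or> y' l \<noteq> 0"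
    using product_agree[OF l(1)] both_zero_iff[OF l(1)] l by auto
  show ?thesis
  proof (cases "y' l = 0")
    case True
    then show ?thesis using one_sided_case[of l] l l' by auto
  next
    case False
    interpret swapped: weighted_values W dual \<alpha> \<gamma> x y y' x' n by (rule swap_target)
    have "(\<Prod>f\<leftarrow>M. y f) = (\<Prod>f\<leftarrow>M. x' f)" if M: "neutral M" for M
    proof -
      have "swapped.neutral (map dual M)"
        using neutral_dual[OF M] by (simp add: neutral_def swapped.neutral_def)
      then have "(\<Prod>f\<leftarrow>map dual M. x f) = (\<Prod>f\<leftarrow>map dual M. y' f)"
        using False l l' by (intro swapped.one_sided_case[of l]) auto
      moreover have "(\<Prod>f\<leftarrow>map dual M. x f) = (\<Prod>f\<leftarrow>M. y f)" "(\<Prod>f\<leftarrow>map dual M. y' f) = (\<Prod>f\<leftarrow>M. x' f)"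
        using M by (auto simp: neutral_def dual_values o_def subset_eq intro!: arg_cong[of _ _ prod_list] map_cong)
      ultimately show ?thesis by simp
    qed
    then show ?thesis by blast
  qed
qed

end


section \<open>Weight functionals and orbits\<close>

definition linear_fun :: "nat \<Rightarrow> ('k::field vec \<Rightarrow> 'k) \<Rightarrow> bool" where
  "linear_fun m F \<longleftrightarrow> (\<exists>c\<in>carrier_vec m. \<forall>v\<in>carrier_vec m. F v = c \<bullet> v)"

lemma linear_fun_add: "linear_fun m F \<Longrightarrow> linear_fun m F' \<Longrightarrow> linear_fun m (\<lambda>v. F v + F' v)"
  unfolding linear_fun_def
proof (elim bexE)
  fix c c' assume "c \<in> carrier_vec m" "c' \<in> carrier_vec m"
    "\<forall>v\<in>carrier_vec m. F v = c \<bullet> v" "\<forall>v\<in>carrier_vec m. F' v = c' \<bullet> v"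
  then show "\<exists>c\<in>carrier_vec m. \<forall>v\<in>carrier_vec m. F v + F' v = c \<bullet> v"
    by (intro bexI[of _ "c + c'"]) (auto simp: add_scalar_prod_distrib)
qed

lemma linear_fun_smult: "linear_fun m F \<Longrightarrow> linear_fun m (\<lambda>v. a * F v)"
  unfolding linear_fun_def
proof (elim bexE)
  fix c assume "c \<in> carrier_vec m" "\<forall>v\<in>carrier_vec m. F v = c \<bullet> v"
  then show "\<exists>c\<in>carrier_vec m. \<forall>v\<in>carrier_vec m. a * F v = c \<bullet> v"
    by (intro bexI[of _ "a \<cdot>\<^sub>v c"]) auto
qed

lemma linear_fun_zero: "linear_fun m (\<lambda>_. 0)"
  unfolding linear_fun_def by (intro bexI[of _ "0\<^sub>v m"]) auto

lemma linear_fun_sum: "(\<And>i. i \<in> I \<Longrightarrow> linear_fun m (F i)) \<Longrightarrow> linear_fun m (\<lambda>v. \<Sum>i\<in>I. F i v)"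
  by (induction I rule: infinite_finite_induct) (auto simp: linear_fun_zero linear_fun_add)

lemma linear_fun_mat:
  assumes "linear_fun m F" and A: "A \<in> carrier_mat m m"
  shows "linear_fun m (\<lambda>v. F (A *\<^sub>v v))"
proof -
  obtain c where c: "c \<in> carrier_vec m" "\<And>v. v \<in> carrier_vec m \<Longrightarrow> F v = c \<bullet> v"
    using assms(1) by (auto simp: linear_fun_def)
  have "F (A *\<^sub>v v) = (transpose_mat A *\<^sub>v c) \<bullet> v" if "v \<in> carrier_vec m" for v
    using c A that transpose_vec_mult_scalar[of A m m v c] by simp
  then show ?thesis
    unfolding linear_fun_def using A c(1)
    by (intro bexI[of _ "transpose_mat A *\<^sub>v c"]) (auto intro!: mult_mat_vec_carrier)
qed

lemma linear_fun_coordinate: "k < m \<Longrightarrow> linear_fun m (\<lambda>v. v $ k)"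
  unfolding linear_fun_def by (intro bexI[of _ "unit_vec m k"]) auto

lemma sum_powers_root_of_unity:
  fixes z :: "'k::field"
  assumes "z ^ k = 1" and "z \<noteq> 1"
  shows "(\<Sum>i<k. z ^ i) = 0"
  using assms geometric_sum[of z k] by simp

lemma representation_mult:
  fixes \<rho> :: "'g \<Rightarrow> 'k::field mat"
  assumes "representation G m \<rho>" and "g \<in> carrier G" "h \<in> carrier G"
  shows "\<rho> (g \<otimes>\<^bsub>G\<^esub> h) = \<rho> g * \<rho> h"
  using hom_mult[OF assms(1)[unfolded representation_def] assms(2,3)]
  by (simp add: GL_def units_of_mult ring_mat_simps)

text \<open>
  In this locale the generators are \<open>a = el 1 False 0\<close>, \<open>b = el 0 True 0\<close> and \<open>c = el 0 False 1\<close>, and the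
  subgroup \<open>A\<close> consists of the elements \<open>el i False e\<close>.
\<close>

locale dihedral_times_two_module =
  fixes n m :: nat and \<rho> :: "(int \<times> bool) \<times> int \<Rightarrow> 'k::field mat" and \<zeta> :: 'k
  assumes n: "n \<ge> 2" "even n"
    and rep: "representation (dihedral_group n \<times>\<times> integer_mod_group 2) m \<rho>"
    and two: "(2::'k) \<noteq> 0" and n_nonzero: "(of_nat n :: 'k) \<noteq> 0"
    and primitive: "\<zeta> ^ n = 1" "\<And>k. 0 < k \<Longrightarrow> k < n \<Longrightarrow> \<zeta> ^ k \<noteq> 1"
begin

abbreviation G where "G \<equiv> dihedral_group n \<times>\<times> integer_mod_group 2"

abbreviation el :: "nat \<Rightarrow> bool \<Rightarrow> nat \<Rightarrow> (int \<times> bool) \<times> int" where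
  "el i s e \<equiv> ((int i, s), int e)"

definition act :: "(int \<times> bool) \<times> int \<Rightarrow> 'k vec \<Rightarrow> 'k vec" where
  "act g v = \<rho> g *\<^sub>v v"

lemmas [simp] = dihedral_carrier carrier_integer_mod_group

lemma G_group: "group G"
  using n by (intro DirProd_group dihedral_is_group) auto

lemma carrier_G: "carrier G = ({0..<int n} \<times> UNIV) \<times> {0..<2}"
  by (simp add: dihedral_carrier carrier_integer_mod_group)

lemma el_in: "i < n \<Longrightarrow> e < 2 \<Longrightarrow> el i s e \<in> carrier G"
  by (simp add: carrier_G)

lemma rho_carrier: "g \<in> carrier G \<Longrightarrow> \<rho> g \<in> carrier_mat m m"
  using representation_carrier[OF rep] .

lemma act_in: "g \<in> carrier G \<Longrightarrow> v \<in> carrier_vec m \<Longrightarrow> act g v \<in> carrier_vec m"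
  unfolding act_def using rho_carrier by (intro mult_mat_vec_carrier)

lemma act_mult:
  assumes "g \<in> carrier G" "h \<in> carrier G" "v \<in> carrier_vec m"
  shows "act g (act h v) = act (g \<otimes>\<^bsub>G\<^esub> h) v"
proof -
  have "\<rho> (g \<otimes>\<^bsub>G\<^esub> h) = \<rho> g * \<rho> h"
    by (rule representation_mult[OF rep assms(1,2)])
  then show ?thesis
    using assms rho_carrier by (simp add: act_def assoc_mult_mat_vec[of _ m m _ m])
qed

lemma act_one:
  assumes "v \<in> carrier_vec m"
  shows "act (el 0 False 0) v = v"
proof -
  have "monoid (ring_mat TYPE('k) m ())"
    using ring_mat by (rule ring.is_monoid)
  then have "group (GL TYPE('k) m)"
    unfolding GL_def by (rule monoid.units_group)
  then have "\<rho> \<one>\<^bsub>G\<^esub> = \<one>\<^bsub>GL TYPE('k) m\<^esub>"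
    using rep G_group by (intro hom_one) (auto simp: representation_def)
  then have "\<rho> (el 0 False 0) = 1\<^sub>m m"
    by (simp add: GL_def units_of_one ring_mat_simps dihedral_one)
  then show ?thesis using assms by (simp add: act_def)
qed

lemma linear_fun_act: "linear_fun m F \<Longrightarrow> g \<in> carrier G \<Longrightarrow> linear_fun m (\<lambda>v. F (act g v))"
  unfolding act_def using rho_carrier by (intro linear_fun_mat)

text \<open>
  A functional is kept together with its eigenvalues, since those of the zero functional are not
  determined by it.
\<close>

definition weight_funs :: "(('k vec \<Rightarrow> 'k) \<times> 'k \<times> 'k) set" where
  "weight_funs = {(F, \<alpha>, \<gamma>). linear_fun m F \<and> \<alpha> ^ n = 1 \<and> \<gamma> ^ 2 = 1 \<and>
     (\<forall>v\<in>carrier_vec m. F (act (el 1 False 0) v) = \<alpha> * F v \<and> F (act (el 0 False 1) v) = \<gamma> * F v)}"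

lemma weight_fun_value:
  assumes f: "(F, \<alpha>, \<gamma>) \<in> weight_funs" and v: "v \<in> carrier_vec m" and "i < n" and e: "e < 2"
  shows "F (act (el i False e) v) = \<alpha> ^ i * \<gamma> ^ e * F v"
  using \<open>i < n\<close>
proof (induction i)
  case 0
  from e have "e = 0 \<or> e = 1" by auto
  then show ?case using f v act_one[OF v] by (auto simp: weight_funs_def)
next
  case (Suc i)
  have "act (el (Suc i) False e) v = act (el 1 False 0) (act (el i False e) v)"
    using Suc.prems n e v by (subst act_mult) (auto simp: el_in dihedral_mult)
  then have "F (act (el (Suc i) False e) v) = \<alpha> * F (act (el i False e) v)"
    using f act_in[OF el_in v, of i e False] Suc.prems e by (simp add: weight_funs_def)
  then show ?case using Suc by simp
qed

text \<open>
  A coordinate \<open>F\<close> that distinguishes the points is the average of the \<open>n\<close> functionals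
  \<open>\<Sum>\<^sub>i \<zeta>\<^sup>-\<^sup>i\<^sup>j F(a\<^sup>i u)\<close>, which are eigenvectors of \<open>a\<close>. One of these still distinguishes the points, and
  it is half of the sum of two common eigenvectors of \<open>a\<close> and \<open>c\<close>.
\<close>

lemma weight_funs_separate:
  assumes v: "v \<in> carrier_vec m" and w: "w \<in> carrier_vec m" and ne: "v \<noteq> w"
  obtains f where "f \<in> weight_funs" and "fst f v \<noteq> fst f w"
proof -
  have el: "el i False 0 \<in> carrier G" if "i < n" for i using that by (simp add: el_in)
  obtain k where k: "k < m" "v $ k \<noteq> w $ k" using v w ne by (auto simp: vec_eq_iff)
  define z where "z = inverse \<zeta>"
  have \<zeta>: "\<zeta> \<noteq> 0" using primitive(1) n by (auto simp: power_0_left)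
  have z: "z ^ n = 1" "\<zeta> * z = 1" using primitive(1) \<zeta> by (simp_all add: z_def power_inverse)
  have z1: "z ^ i \<noteq> 1" if "0 < i" "i < n" for i
    using primitive(2)[OF that] by (simp add: z_def power_inverse)
  define F where "F j u = (\<Sum>i<n. (z ^ i) ^ j * act (el i False 0) u $ k)" for j u
  have F_lin: "linear_fun m (F j)" for j
    unfolding F_def by (intro linear_fun_sum linear_fun_smult linear_fun_act linear_fun_coordinate k el) auto
  have F_a: "F j (act (el 1 False 0) u) = \<zeta> ^ j * F j u" if u: "u \<in> carrier_vec m" for j u
  proof -
    define \<Phi> where "\<Phi> i = (z ^ i) ^ j * act ((int i mod int n, False), 0) u $ k" for i
    have "F j (act (el 1 False 0) u) = (\<Sum>i<n. (z ^ i) ^ j * act ((int (Suc i) mod int n, False), 0) u $ k)"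
      unfolding F_def using u n
      by (intro sum.cong refl) (simp add: act_mult el_in dihedral_mult add.commute)
    also have "\<dots> = (\<Sum>i<n. \<zeta> ^ j * \<Phi> (Suc i))"
    proof (intro sum.cong refl)
      fix i
      have "(z ^ i) ^ j = (\<zeta> * z) ^ j * (z ^ i) ^ j" by (simp add: z)
      also have "\<dots> = \<zeta> ^ j * (z ^ Suc i) ^ j" by (simp add: power_mult_distrib mult.assoc)
      finally show "(z ^ i) ^ j * act ((int (Suc i) mod int n, False), 0) u $ k = \<zeta> ^ j * \<Phi> (Suc i)"
        by (simp add: \<Phi>_def)
    qed
    also have "\<dots> = \<zeta> ^ j * (\<Sum>i<n. \<Phi> (Suc i))" by (simp add: sum_distrib_left)
    also have "(\<Sum>i<n. \<Phi> (Suc i)) = (\<Sum>i<n. \<Phi> i)"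
    proof -
      have "\<Phi> n = \<Phi> 0" using z by (simp add: \<Phi>_def)
      moreover have "(\<Sum>i<Suc n. \<Phi> i) = \<Phi> 0 + (\<Sum>i<n. \<Phi> (Suc i))" by (rule sum.lessThan_Suc_shift)
      ultimately show ?thesis by simp
    qed
    also have "(\<Sum>i<n. \<Phi> i) = F j u" by (simp add: F_def \<Phi>_def)
    finally show ?thesis .
  qed
  have F_sum: "(\<Sum>j<n. F j u) = of_nat n * u $ k" if u: "u \<in> carrier_vec m" for u
  proof -
    have "(\<Sum>j<n. F j u) = (\<Sum>i<n. (\<Sum>j<n. (z ^ i) ^ j) * act (el i False 0) u $ k)"
      unfolding F_def by (subst sum.swap) (simp add: sum_distrib_right)
    also have "\<dots> = (\<Sum>i<n. if i = 0 then of_nat n * u $ k else 0)"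
    proof (intro sum.cong refl)
      fix i assume "i \<in> {..<n}"
      then show "(\<Sum>j<n. (z ^ i) ^ j) * act (el i False 0) u $ k = (if i = 0 then of_nat n * u $ k else 0)"
        using act_one[OF u] sum_powers_root_of_unity[of "z ^ i" n] z1[of i] z(1)
        by (cases "i = 0") (auto simp: power_mult[symmetric] mult.commute[of i], simp add: power_mult)
    qed
    also have "\<dots> = of_nat n * u $ k" using n by simp
    finally show ?thesis .
  qed
  obtain j where j: "F j v \<noteq> F j w"
  proof (rule ccontr)
    assume "\<not> thesis"
    then have "F j v = F j w" for j using that by blast
    then have "(\<Sum>j<n. F j v) = (\<Sum>j<n. F j w)" by simp
    then have "of_nat n * v $ k = of_nat n * w $ k" by (simp only: F_sum[OF v] F_sum[OF w])
    then show False using k n_nonzero by simp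
  qed
  have c_in: "el 0 False 1 \<in> carrier G" and a_in: "el 1 False 0 \<in> carrier G" using n by (auto intro: el_in)
  define H where "H s u = F j u + s * F j (act (el 0 False 1) u)" for s u
  have H: "(H s, \<zeta> ^ j, s) \<in> weight_funs" if s: "s * s = 1" for s
  proof -
    have "H s (act (el 1 False 0) u) = \<zeta> ^ j * H s u" if u: "u \<in> carrier_vec m" for u
    proof -
      have "act (el 0 False 1) (act (el 1 False 0) u) = act (el 1 False 0) (act (el 0 False 1) u)"
        using u a_in c_in n by (simp add: act_mult dihedral_mult)
      then show ?thesis using u act_in[OF c_in u] by (simp add: H_def F_a[simplified] algebra_simps)
    qed
    moreover have "H s (act (el 0 False 1) u) = s * H s u" if u: "u \<in> carrier_vec m" for u
    proof -
      have "act (el 0 False 1) (act (el 0 False 1) u) = u"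
        using u c_in n act_one[OF u] by (simp add: act_mult dihedral_mult)
      moreover have "s * (s * y) = y" for y using s by (simp flip: mult.assoc)
      ultimately show ?thesis by (simp add: H_def algebra_simps)
    qed
    moreover have "linear_fun m (H s)"
      unfolding H_def by (intro linear_fun_add linear_fun_smult linear_fun_act F_lin c_in)
    moreover have "(\<zeta> ^ j) ^ n = 1" using primitive(1) by (metis power_commutes power_mult power_one mult.commute)
    ultimately show ?thesis using s by (auto simp: weight_funs_def power2_eq_square)
  qed
  have "H 1 v + H (- 1) v = 2 * F j v" "H 1 w + H (- 1) w = 2 * F j w" by (simp_all add: H_def)
  then have "H 1 v \<noteq> H 1 w \<or> H (- 1) v \<noteq> H (- 1) w" using j two by auto
  then show thesis using that[OF H[of 1]] that[OF H[of "-1"]] by auto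
qed

text \<open>
  The sum is over the subgroup \<open>A\<close>, not over the whole group.
\<close>

definition orbit_sum :: "('k vec \<Rightarrow> 'k) \<Rightarrow> 'k vec \<Rightarrow> 'k" where
  "orbit_sum \<Phi> u = (\<Sum>i<n. \<Sum>e<2. \<Phi> (act (el i False e) u))"

definition neutral :: "(('k vec \<Rightarrow> 'k) \<times> 'k \<times> 'k) list \<Rightarrow> bool" where
  "neutral M \<longleftrightarrow> set M \<subseteq> weight_funs \<and> (\<Prod>f\<leftarrow>M. fst (snd f)) = 1 \<and> (\<Prod>f\<leftarrow>M. snd (snd f)) = 1"

lemma prod_list_weight_value:
  assumes "set M \<subseteq> weight_funs" and u: "u \<in> carrier_vec m" and "i < n" "e < 2"
  shows "(\<Prod>f\<leftarrow>M. fst f (act (el i False e) u)) =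
    (\<Prod>f\<leftarrow>M. fst (snd f)) ^ i * (\<Prod>f\<leftarrow>M. snd (snd f)) ^ e * (\<Prod>f\<leftarrow>M. fst f u)"
  using assms(1)
proof (induction M)
  case (Cons f M)
  obtain F \<alpha> \<gamma> where f: "f = (F, \<alpha>, \<gamma>)" by (cases f)
  with Cons weight_fun_value[of F \<alpha> \<gamma> u i e] assms(2-4) show ?case
    by (simp add: power_mult_distrib mult_ac)
qed simp

lemma orbit_sum_neutral:
  assumes "neutral M" and "u \<in> carrier_vec m"
  shows "orbit_sum (\<lambda>u. \<Prod>f\<leftarrow>M. fst f u) u = of_nat (2 * n) * (\<Prod>f\<leftarrow>M. fst f u)"
  using assms by (simp add: orbit_sum_def neutral_def prod_list_weight_value)

lemma orbit_sum_not_neutral: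
  assumes M: "set M \<subseteq> weight_funs" "\<not> neutral M" and u: "u \<in> carrier_vec m"
  shows "orbit_sum (\<lambda>u. \<Prod>f\<leftarrow>M. fst f u) u = 0"
proof -
  define \<alpha> \<gamma> where "\<alpha> = (\<Prod>f\<leftarrow>M. fst (snd f))" and "\<gamma> = (\<Prod>f\<leftarrow>M. snd (snd f))"
  have "(\<Prod>f\<leftarrow>M. fst (snd f)) ^ n = 1 \<and> (\<Prod>f\<leftarrow>M. snd (snd f)) ^ 2 = 1"
    using M(1) by (induction M) (auto simp: weight_funs_def power_mult_distrib)
  then have one: "\<alpha> ^ n = 1" "\<gamma> ^ 2 = 1" by (simp_all add: \<alpha>_def \<gamma>_def)
  have "orbit_sum (\<lambda>u. \<Prod>f\<leftarrow>M. fst f u) u = (\<Sum>i<n. \<Sum>e<2. \<alpha> ^ i * \<gamma> ^ e * (\<Prod>f\<leftarrow>M. fst f u))"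
    unfolding orbit_sum_def \<alpha>_def \<gamma>_def using M(1) u
    by (intro sum.cong refl prod_list_weight_value) auto
  also have "\<dots> = (\<Sum>i<n. \<alpha> ^ i) * (\<Sum>e<2. \<gamma> ^ e) * (\<Prod>f\<leftarrow>M. fst f u)"
    by (simp flip: sum_distrib_left sum_distrib_right)
  also have "\<dots> = 0"
    using M one sum_powers_root_of_unity[of \<alpha> n] sum_powers_root_of_unity[of \<gamma> 2]
    by (auto simp: neutral_def \<alpha>_def \<gamma>_def)
  finally show ?thesis .
qed

text \<open>
  Sums over \<open>A\<close> of products of weight functionals agree at \<open>p\<close> and \<open>q\<close>, because they vanish for products
  that are not neutral. By expanding the factors, the same holds for products of functions
  \<open>F - const\<close>. If \<open>q\<close> is not in the orbit of \<open>p\<close>, then for each \<open>z\<close> in the orbit of \<open>q\<close> there is such a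
  product that vanishes on both orbits except at \<open>z\<close>. Hence the number of elements of \<open>A\<close> that map \<open>q\<close> to
  \<open>z\<close> is zero in \<open>K\<close>. Summing over \<open>z\<close> gives \<open>2n = 0\<close> in \<open>K\<close>, which is false.
\<close>

lemma neutral_products_separate_orbits:
  assumes p: "p \<in> carrier_vec m" and q: "q \<in> carrier_vec m"
    and eq: "\<And>M. neutral M \<Longrightarrow> (\<Prod>f\<leftarrow>M. fst f p) = (\<Prod>f\<leftarrow>M. fst f q)"
  shows "\<exists>i<n. \<exists>e<2. q = act (el i False e) p"
proof (rule ccontr)
  assume no: "\<not> ?thesis"
  have eq1: "orbit_sum (\<lambda>u. \<Prod>f\<leftarrow>M. fst f u) p = orbit_sum (\<lambda>u. \<Prod>f\<leftarrow>M. fst f u) q"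
    if "set M \<subseteq> weight_funs" for M
    using that p q eq by (cases "neutral M") (simp_all add: orbit_sum_neutral orbit_sum_not_neutral)
  have eq2: "orbit_sum (\<lambda>u. (\<Prod>f\<leftarrow>M. fst f u) * (\<Prod>(f, c)\<leftarrow>Z. fst f u - c)) p =
      orbit_sum (\<lambda>u. (\<Prod>f\<leftarrow>M. fst f u) * (\<Prod>(f, c)\<leftarrow>Z. fst f u - c)) q"
    if "set M \<subseteq> weight_funs" "fst ` set Z \<subseteq> weight_funs" for M Z
    using that
  proof (induction Z arbitrary: M)
    case Nil
    then show ?case using eq1 by simp
  next
    case (Cons fc Z)
    obtain f c where fc: "fc = (f, c)" by (cases fc)
    have split: "orbit_sum (\<lambda>u. (\<Prod>f\<leftarrow>M. fst f u) * (\<Prod>(f, c)\<leftarrow>fc # Z. fst f u - c)) r =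
        orbit_sum (\<lambda>u. (\<Prod>f\<leftarrow>f # M. fst f u) * (\<Prod>(f, c)\<leftarrow>Z. fst f u - c)) r -
        c * orbit_sum (\<lambda>u. (\<Prod>f\<leftarrow>M. fst f u) * (\<Prod>(f, c)\<leftarrow>Z. fst f u - c)) r" for r
      by (simp add: orbit_sum_def fc sum_distrib_left sum_subtractf[symmetric] algebra_simps)
    show ?case
      unfolding split using Cons.IH[of M] Cons.IH[of "f # M"] Cons.prems fc by simp
  qed
  define orb where "orb u = (\<lambda>(i, e). act (el i False e) u) ` ({..<n} \<times> {..<2})" for u
  have orb_fin: "finite (orb u)" for u by (simp add: orb_def)
  have orb_in: "orb u \<subseteq> carrier_vec m" if "u \<in> carrier_vec m" for u
    using that by (auto simp: orb_def intro: act_in el_in)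
  have disjoint: "orb p \<inter> orb q = {}"
  proof (rule ccontr)
    assume "orb p \<inter> orb q \<noteq> {}"
    then obtain i e j d where ij: "i < n" "j < n" "e < 2" "d < 2"
      and eq: "act (el i False e) p = act (el j False d) q"
      by (auto simp: orb_def)
    define t where "t = nat ((- int j) mod int n)"
    have t: "t < n" "int t = (- int j) mod int n" using n by (auto simp: t_def nat_less_iff)
    have "act (el t False d) (act (el j False d) q) = act (el 0 False 0) q"
      using ij t q n by (subst act_mult) (auto simp: el_in dihedral_mult mod_simps less_2_cases_iff)
    then have "q = act (el t False d) (act (el i False e) p)"
      using eq act_one[OF q] by simp
    also have "\<dots> = act (((int t + int i) mod int n, False), (int d + int e) mod 2) p"
      using ij t p by (subst act_mult) (auto simp: el_in dihedral_mult)
    also have "\<dots> = act (el ((t + i) mod n) False ((d + e) mod 2)) p"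
      by (simp add: zmod_int)
    finally have "q = act (el ((t + i) mod n) False ((d + e) mod 2)) p" .
    moreover have "(t + i) mod n < n" "(d + e) mod 2 < 2" using n by auto
    ultimately show False using no by blast
  qed
  \<comment> \<open>the number of elements that map q to z, counted in the field\<close>
  have count: "(\<Sum>i<n. \<Sum>e<2. if act (el i False e) q = z then 1 else 0) = (0::'k)" if z: "z \<in> orb q" for z
  proof -
    define Y where "Y = (orb p \<union> orb q) - {z}"
    have Y: "finite Y" "Y \<subseteq> carrier_vec m" using orb_fin orb_in p q by (auto simp: Y_def)
    have zc: "z \<in> carrier_vec m" using z orb_in[OF q] by auto
    have "\<forall>y\<in>Y. \<exists>f. f \<in> weight_funs \<and> fst f y \<noteq> fst f z"
    proof
      fix y assume "y \<in> Y"
      then have y: "y \<in> carrier_vec m" "y \<noteq> z" using Y by (auto simp: Y_def)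
      show "\<exists>f. f \<in> weight_funs \<and> fst f y \<noteq> fst f z"
        by (rule weight_funs_separate[OF y(1) zc y(2)]) blast
    qed
    then obtain f where f: "\<And>y. y \<in> Y \<Longrightarrow> f y \<in> weight_funs" "\<And>y. y \<in> Y \<Longrightarrow> fst (f y) y \<noteq> fst (f y) z"
      by metis
    obtain ys where ys: "set ys = Y" using finite_list[OF Y(1)] by blast
    define Z where "Z = map (\<lambda>y. (f y, fst (f y) y)) ys"
    define \<Phi> where "\<Phi> u = (\<Prod>(f, c)\<leftarrow>Z. fst f u - c)" for u
    have \<Phi>0: "\<Phi> y = 0" if "y \<in> Y" for y
      using that ys by (auto simp: \<Phi>_def Z_def prod_list_zero_iff o_def)
    have \<Phi>z: "\<Phi> z \<noteq> 0"
      using ys f(2)[symmetric] by (auto simp: \<Phi>_def Z_def prod_list_zero_iff o_def)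
    have "orbit_sum \<Phi> p = orbit_sum \<Phi> q"
      using eq2[of "[]" Z] f(1) ys by (simp add: \<Phi>_def[abs_def] Z_def image_subset_iff)
    moreover have "orbit_sum \<Phi> p = 0"
      unfolding orbit_sum_def
    proof (intro sum.neutral ballI \<Phi>0)
      fix i e :: nat assume "i \<in> {..<n}" "e \<in> {..<2}"
      then have "act (el i False e) p \<in> orb p" by (auto simp: orb_def)
      then show "act (el i False e) p \<in> Y" using z disjoint by (auto simp: Y_def)
    qed
    moreover have "orbit_sum \<Phi> q = (\<Sum>i<n. \<Sum>e<2. (if act (el i False e) q = z then 1 else 0) * \<Phi> z)"
      unfolding orbit_sum_def
    proof (intro sum.cong refl)
      fix i e :: nat assume "i \<in> {..<n}" "e \<in> {..<2}"
      then have "act (el i False e) q \<in> orb q" by (auto simp: orb_def)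
      then show "\<Phi> (act (el i False e) q) = (if act (el i False e) q = z then 1 else 0) * \<Phi> z"
        using \<Phi>0 by (auto simp: Y_def)
    qed
    ultimately have "(\<Sum>i<n. \<Sum>e<2. (if act (el i False e) q = z then 1 else 0)) * \<Phi> z = 0"
      by (simp only: sum_distrib_right)
    then show ?thesis using \<Phi>z by simp
  qed
  have "(\<Sum>z\<in>orb q. \<Sum>i<n. \<Sum>e<2. if act (el i False e) q = z then 1 else 0) = (0::'k)"
    using count by (intro sum.neutral) auto
  moreover have "(\<Sum>z\<in>orb q. \<Sum>i<n. \<Sum>e<2. if act (el i False e) q = z then 1 else 0) =
      (\<Sum>i<n. \<Sum>e<2. \<Sum>z\<in>orb q. if act (el i False e) q = z then 1 else (0::'k))"
    by (subst sum.swap, intro sum.cong refl, rule sum.swap)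
  moreover have "\<dots> = (\<Sum>i<n. \<Sum>e<(2::nat). 1)"
    using orb_fin by (intro sum.cong refl) (auto simp: sum.delta orb_def)
  ultimately have "of_nat n * 2 = (0::'k)" by simp
  then show False using two n_nonzero by simp
qed

text \<open>
  The sum over the whole group is the sum of two sums over \<open>A\<close>, at \<open>u\<close> and at \<open>bu\<close>. For a neutral product
  it equals \<open>2n\<close> times the sum of the two values, so that the hypothesis is the one of \<open>weighted_values\<close>.
\<close>

lemma agreement_implies_same_orbit:
  assumes v: "v \<in> carrier_vec m" and w: "w \<in> carrier_vec m"
    and agree: "\<And>Fs. \<lbrakk>\<And>F. F \<in> set Fs \<Longrightarrow> linear_fun m F; length Fs \<le> n + 2\<rbrakk> \<Longrightarrow>
      (\<Sum>g\<in>carrier G. \<Prod>F\<leftarrow>Fs. F (act g v)) = (\<Sum>g\<in>carrier G. \<Prod>F\<leftarrow>Fs. F (act g w))"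
  shows "same_orbit G \<rho> v w"
proof -
  define b where "b = el 0 True 0"
  have b: "b \<in> carrier G" using n by (simp add: b_def el_in)
  have bb: "act b (act b u) = u" if "u \<in> carrier_vec m" for u
    using that b act_one[OF that] unfolding b_def by (simp add: act_mult dihedral_mult)
  have a: "el 1 False 0 \<in> carrier G" and c: "el 0 False 1 \<in> carrier G" using n by (auto intro: el_in)
  have aba: "act (el 1 False 0) (act b (act (el 1 False 0) u)) = act b u"
    and bc: "act b (act (el 0 False 1) u) = act (el 0 False 1) (act b u)" if "u \<in> carrier_vec m" for u
  proof -
    have ba: "b \<otimes>\<^bsub>G\<^esub> el 1 False 0 \<in> carrier G"
      using group.is_monoid[OF G_group] a b by (intro monoid.m_closed)
    show "act (el 1 False 0) (act b (act (el 1 False 0) u)) = act b u"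
      using that a b ba by (simp add: act_mult) (simp add: b_def dihedral_mult mod_simps)
    show "act b (act (el 0 False 1) u) = act (el 0 False 1) (act b u)"
      using that c b by (simp add: act_mult) (simp add: b_def dihedral_mult)
  qed
  define dual :: "('k vec \<Rightarrow> 'k) \<times> 'k \<times> 'k \<Rightarrow> ('k vec \<Rightarrow> 'k) \<times> 'k \<times> 'k" where
    "dual = (\<lambda>(F, \<alpha>, \<gamma>). ((\<lambda>u. F (act b u)), inverse \<alpha>, inverse \<gamma>))"
  have dual_in: "dual f \<in> weight_funs" if "f \<in> weight_funs" for f
  proof -
    obtain F \<alpha> \<gamma> where f: "f = (F, \<alpha>, \<gamma>)" by (cases f)
    have F: "linear_fun m F" "\<alpha> ^ n = 1" "\<gamma> ^ 2 = 1"
      and Fa: "\<And>u. u \<in> carrier_vec m \<Longrightarrow> F (act (el 1 False 0) u) = \<alpha> * F u"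
      and Fc: "\<And>u. u \<in> carrier_vec m \<Longrightarrow> F (act (el 0 False 1) u) = \<gamma> * F u"
      using that by (auto simp: weight_funs_def f)
    have nz: "\<alpha> \<noteq> 0" "\<gamma> \<noteq> 0" using F n by (auto simp: power_0_left)
    have \<gamma>: "inverse \<gamma> = \<gamma>" using F(3) nz by (simp add: power2_eq_square field_simps)
    have "F (act b (act (el 1 False 0) u)) = inverse \<alpha> * F (act b u)" if u: "u \<in> carrier_vec m" for u
    proof -
      have "F (act b u) = \<alpha> * F (act b (act (el 1 False 0) u))"
        using Fa[of "act b (act (el 1 False 0) u)"] aba[OF u] act_in a b u by simp
      then show ?thesis using nz by (simp add: field_simps)
    qed
    moreover have "F (act b (act (el 0 False 1) u)) = \<gamma> * F (act b u)" if u: "u \<in> carrier_vec m" for u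
      using Fc[of "act b u"] bc[OF u] act_in b u by simp
    moreover have "linear_fun m (\<lambda>u. F (act b u))"
      by (rule linear_fun_act[OF F(1) b])
    ultimately show ?thesis
      using F a c act_in by (simp add: f dual_def weight_funs_def \<gamma> power_inverse)
  qed
  have total: "(\<Sum>g\<in>carrier G. \<Phi> (act g u)) = orbit_sum \<Phi> u + orbit_sum \<Phi> (act b u)"
    if u: "u \<in> carrier_vec m" for u and \<Phi> :: "'k vec \<Rightarrow> 'k"
  proof -
    have im: "carrier G = (\<lambda>(s, i, e). el i s e) ` (UNIV \<times> {..<n} \<times> {..<2})"
    proof (intro equalityI subsetI)
      fix g assume "g \<in> carrier G"
      then obtain i s e where "g = ((i, s), e)" "0 \<le> i" "i < int n" "0 \<le> e" "e < 2"
        by (auto simp: carrier_G)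
      then show "g \<in> (\<lambda>(s, i, e). el i s e) ` (UNIV \<times> {..<n} \<times> {..<2})"
        by (intro image_eqI[of _ _ "(s, nat i, nat e)"]) auto
    qed (auto simp: carrier_G)
    have "(\<Sum>g\<in>carrier G. \<Phi> (act g u)) = (\<Sum>(s, i, e)\<in>UNIV \<times> {..<n} \<times> {..<2}. \<Phi> (act (el i s e) u))"
      unfolding im by (subst sum.reindex) (auto simp: inj_on_def intro!: sum.cong)
    also have "\<dots> = (\<Sum>s\<in>UNIV. \<Sum>i<n. \<Sum>e<2. \<Phi> (act (el i s e) u))"
      by (simp only: sum.cartesian_product)
    also have "\<dots> = orbit_sum \<Phi> u + (\<Sum>i<n. \<Sum>e<2. \<Phi> (act (el i True e) u))"
      by (simp add: UNIV_bool orbit_sum_def)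
    also have "(\<Sum>i<n. \<Sum>e<2. \<Phi> (act (el i True e) u)) = orbit_sum \<Phi> (act b u)"
      unfolding orbit_sum_def b_def using u
      by (intro sum.cong refl) (simp add: act_mult el_in dihedral_mult)
    finally show ?thesis .
  qed
  have swap: "fst (dual f) u = fst f (act b u)" for f u
    by (cases f) (simp add: dual_def)
  interpret core: weighted_values weight_funs dual "\<lambda>f. fst (snd f)" "\<lambda>f. snd (snd f)"
    "\<lambda>f. fst f v" "\<lambda>f. fst f (act b v)" "\<lambda>f. fst f w" "\<lambda>f. fst f (act b w)" n
  proof
    show "n \<ge> 2" "even n" "(2::'k) \<noteq> 0" by (fact n two)+
    fix f assume f: "f \<in> weight_funs"
    show "fst (snd f) ^ n = 1" "snd (snd f) ^ 2 = 1" using f by (auto simp: weight_funs_def)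
    show "dual f \<in> weight_funs" by (rule dual_in[OF f])
    show "fst (snd (dual f)) = inverse (fst (snd f))" "snd (snd (dual f)) = inverse (snd (snd f))"
      by (simp_all add: dual_def split: prod.split)
    show "fst (dual f) v = fst f (act b v)" "fst (dual f) w = fst f (act b w)"
      "fst (dual f) (act b v) = fst f v" "fst (dual f) (act b w) = fst f w"
      using v w by (simp_all add: swap bb)
  next
    fix M :: "(('k vec \<Rightarrow> 'k) \<times> 'k \<times> 'k) list"
    assume M: "set M \<subseteq> weight_funs" "(\<Prod>f\<leftarrow>M. fst (snd f)) = 1" "(\<Prod>f\<leftarrow>M. snd (snd f)) = 1" "length M \<le> n + 2"
    have neutral: "neutral M" using M by (simp add: neutral_def)
    have "(\<Sum>g\<in>carrier G. \<Prod>f\<leftarrow>M. fst f (act g u)) =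
        of_nat (2 * n) * ((\<Prod>f\<leftarrow>M. fst f u) + (\<Prod>f\<leftarrow>M. fst f (act b u)))" if "u \<in> carrier_vec m" for u
      using that total[OF that, of "\<lambda>u. \<Prod>f\<leftarrow>M. fst f u"] orbit_sum_neutral[OF neutral] act_in[OF b that]
      by (simp add: distrib_left)
    moreover have "(\<Sum>g\<in>carrier G. \<Prod>f\<leftarrow>M. fst f (act g v)) = (\<Sum>g\<in>carrier G. \<Prod>f\<leftarrow>M. fst f (act g w))"
    proof -
      have "linear_fun m F" if "F \<in> set (map fst M)" for F
        using that M(1) by (force simp: weight_funs_def)
      then show ?thesis using agree[of "map fst M"] M(4) by (simp add: o_def)
    qed
    ultimately have "of_nat (2 * n) * ((\<Prod>f\<leftarrow>M. fst f v) + (\<Prod>f\<leftarrow>M. fst f (act b v))) =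
        of_nat (2 * n) * ((\<Prod>f\<leftarrow>M. fst f w) + (\<Prod>f\<leftarrow>M. fst f (act b w)))"
      using v w by simp
    then show "(\<Prod>f\<leftarrow>M. fst f v) + (\<Prod>f\<leftarrow>M. fst f (act b v)) = (\<Prod>f\<leftarrow>M. fst f w) + (\<Prod>f\<leftarrow>M. fst f (act b w))"
      using two n_nonzero by simp
  qed
  have orbit: "same_orbit G \<rho> v w" if "g \<in> carrier G" "w = act g v" for g
    using that by (auto simp: same_orbit_def act_def)
  from core.neutral_products_agree show ?thesis
  proof
    assume "\<forall>M. core.neutral M \<longrightarrow> (\<Prod>f\<leftarrow>M. fst f v) = (\<Prod>f\<leftarrow>M. fst f w)"
    then have "\<exists>i<n. \<exists>e<2. w = act (el i False e) v"
      using v w by (intro neutral_products_separate_orbits) (auto simp: neutral_def core.neutral_def)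
    then show ?thesis using orbit el_in by blast
  next
    assume "\<forall>M. core.neutral M \<longrightarrow> (\<Prod>f\<leftarrow>M. fst f (act b v)) = (\<Prod>f\<leftarrow>M. fst f w)"
    then have "\<exists>i<n. \<exists>e<2. w = act (el i False e) (act b v)"
      using act_in[OF b v] w by (intro neutral_products_separate_orbits) (auto simp: neutral_def core.neutral_def)
    then obtain i e where ie: "i < n" "e < 2" "w = act (el i False e) (act b v)" by blast
    then have "w = act (el i False e \<otimes>\<^bsub>G\<^esub> b) v" using act_mult[OF el_in b v] by simp
    moreover have "el i False e \<otimes>\<^bsub>G\<^esub> b \<in> carrier G"
      using group.is_monoid[OF G_group] el_in[OF ie(1,2)] b by (intro monoid.m_closed)
    ultimately show ?thesis using orbit by blast
  qed
qed

end


section \<open>Invariants from sums over the group\<close>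

text \<open>
  The linear form \<open>v \<mapsto> c \<bullet> v\<close> as a formal polynomial.
\<close>

definition vec_form :: "nat \<Rightarrow> 'k::field vec \<Rightarrow> 'k mpoly" where
  "vec_form m c = (\<Sum>j<m. Poly_Mapping.single (Poly_Mapping.single j 1) (c $ j))"

lemma single_sum: "Poly_Mapping.single t (\<Sum>i\<in>I. f i) = (\<Sum>i\<in>I. Poly_Mapping.single t (f i))"
  by (induction I rule: infinite_finite_induct) (simp_all add: single_add)

lemma monom_degree_add: "monom_degree (s + t) = monom_degree s + monom_degree t"
proof -
  let ?U = "Poly_Mapping.keys s \<union> Poly_Mapping.keys t"
  have ext: "(\<Sum>i\<in>Poly_Mapping.keys u. Poly_Mapping.lookup u i) = (\<Sum>i\<in>?U. Poly_Mapping.lookup u i)"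
    if "Poly_Mapping.keys u \<subseteq> ?U" for u
    using that by (intro sum.mono_neutral_left) (auto simp: in_keys_iff)
  show ?thesis
    unfolding monom_degree_def ext[OF Poly_Mapping.keys_add] ext[OF Un_upper1] ext[OF Un_upper2]
    by (simp add: lookup_add sum.distrib)
qed

definition forms :: "nat \<Rightarrow> nat \<Rightarrow> 'k::field mpoly set" where
  "forms m d = {f \<in> coord_ring m. homogeneous d f}"

lemma forms_iff: "f \<in> forms m d \<longleftrightarrow>
    (\<forall>t\<in>Poly_Mapping.keys f. Poly_Mapping.keys t \<subseteq> {..<m} \<and> monom_degree t = d)"
  by (auto simp: forms_def coord_ring_def homogeneous_def)

lemma zero_in_forms: "0 \<in> forms m d"
  by (simp add: forms_iff)

lemma add_in_forms: "f \<in> forms m d \<Longrightarrow> g \<in> forms m d \<Longrightarrow> f + g \<in> forms m d"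
  using Poly_Mapping.keys_add[of f g] by (fastforce simp: forms_iff)

lemma sum_in_forms: "(\<And>i. i \<in> I \<Longrightarrow> f i \<in> forms m d) \<Longrightarrow> (\<Sum>i\<in>I. f i) \<in> forms m d"
  by (induction I rule: infinite_finite_induct) (auto intro: zero_in_forms add_in_forms)

lemma mult_in_forms:
  assumes "f \<in> forms m d" and "g \<in> forms m e"
  shows "f * g \<in> forms m (d + e)"
  unfolding forms_iff
proof
  fix t assume "t \<in> Poly_Mapping.keys (f * g)"
  then obtain a b where t: "t = a + b" "a \<in> Poly_Mapping.keys f" "b \<in> Poly_Mapping.keys g"
    using keys_mult[of f g] by auto
  then show "Poly_Mapping.keys t \<subseteq> {..<m} \<and> monom_degree t = d + e"
    using assms Poly_Mapping.keys_add[of a b] by (fastforce simp: forms_iff monom_degree_add)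
qed

lemma vec_form_in_forms: "vec_form m c \<in> forms m 1"
  unfolding vec_form_def
  by (intro sum_in_forms) (auto simp: forms_iff monom_degree_def)

lemma prod_vec_form_in_forms: "(\<Prod>c\<leftarrow>cs. vec_form m (h c)) \<in> forms m (length cs)"
proof (induction cs)
  case Nil
  show ?case by (simp add: forms_iff monom_degree_def)
next
  case (Cons c cs)
  show ?case using mult_in_forms[OF vec_form_in_forms[of m "h c"] Cons] by simp
qed

lemma mpoly_eval_vec_form:
  assumes "c \<in> carrier_vec m" "v \<in> carrier_vec m"
  shows "mpoly_eval (vec_form m c) v = c \<bullet> v"
proof -
  have "mpoly_eval (vec_form m c) v = (\<Sum>j<m. c $ j * v $ j)"
    unfolding vec_form_def mpoly_eval_sum
    by (rule sum.cong) (auto simp: mpoly_eval_def mpoly_subst_single)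
  then show ?thesis using assms by (simp add: scalar_prod_def lessThan_atLeast0)
qed

lemma action_mult: "action G m \<rho> h (f * g) = action G m \<rho> h f * action G m \<rho> h g"
  unfolding action_def by (rule mpoly_subst_mult) (auto simp: single_add mult_single)

lemma action_one: "action G m \<rho> h 1 = 1"
  unfolding action_def single_one[symmetric] by (subst mpoly_subst_single) auto

lemma action_sum: "action G m \<rho> h (\<Sum>i\<in>I. f i) = (\<Sum>i\<in>I. action G m \<rho> h (f i))"
  unfolding action_def by (rule mpoly_subst_sum) (auto simp: single_add)

lemma action_prod_list: "action G m \<rho> h (\<Prod>f\<leftarrow>fs. k f) = (\<Prod>f\<leftarrow>fs. action G m \<rho> h (k f))"
  by (induction fs) (simp_all add: action_one action_mult)

lemma action_vec_form:
  assumes A: "\<rho> (inv\<^bsub>G\<^esub> h) \<in> carrier_mat m m" and c: "c \<in> carrier_vec m"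
  shows "action G m \<rho> h (vec_form m c) = vec_form m (transpose_mat (\<rho> (inv\<^bsub>G\<^esub> h)) *\<^sub>v c)"
proof -
  let ?A = "\<rho> (inv\<^bsub>G\<^esub> h)"
  have "action G m \<rho> h (vec_form m c) = (\<Sum>j<m. Poly_Mapping.single 0 (c $ j) * linear_form m ?A j)"
    unfolding vec_form_def action_sum
    by (intro sum.cong refl) (simp add: action_def mpoly_subst_single)
  also have "\<dots> = (\<Sum>j<m. \<Sum>k<m. Poly_Mapping.single (Poly_Mapping.single k 1) (c $ j * ?A $$ (j, k)))"
    by (simp add: linear_form_def sum_distrib_left mult_single)
  also have "\<dots> = (\<Sum>k<m. Poly_Mapping.single (Poly_Mapping.single k 1) (\<Sum>j<m. c $ j * ?A $$ (j, k)))"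
    by (subst sum.swap) (simp add: single_sum)
  also have "\<dots> = vec_form m (transpose_mat ?A *\<^sub>v c)"
    unfolding vec_form_def using A c
    by (intro sum.cong refl arg_cong[of _ _ "Poly_Mapping.single _"])
       (auto simp: scalar_prod_def lessThan_atLeast0 mult.commute intro!: sum.cong)
  finally show ?thesis .
qed

text \<open>
  The sum over the group of the translates of a product of linear forms. It is invariant as a formal
  polynomial, not merely as a function, which matters for finite fields.
\<close>

definition reynolds_form ::
    "('g, 'b) monoid_scheme \<Rightarrow> nat \<Rightarrow> ('g \<Rightarrow> 'k::field mat) \<Rightarrow> 'k vec list \<Rightarrow> 'k mpoly" where
  "reynolds_form G m \<rho> cs = (\<Sum>g\<in>carrier G. \<Prod>c\<leftarrow>cs. vec_form m (transpose_mat (\<rho> g) *\<^sub>v c))"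

lemma reynolds_form_in_forms: "reynolds_form G m \<rho> cs \<in> forms m (length cs)"
  unfolding reynolds_form_def by (intro sum_in_forms prod_vec_form_in_forms)

lemma reynolds_form_invariant:
  assumes G: "group G" and rep: "representation G m \<rho>" and cs: "set cs \<subseteq> carrier_vec m"
  shows "reynolds_form G m \<rho> cs \<in> invariants G m \<rho>"
proof -
  interpret group G by fact
  have car: "\<rho> g \<in> carrier_mat m m" if "g \<in> carrier G" for g
    using representation_carrier[OF rep that] .
  have "action G m \<rho> h (reynolds_form G m \<rho> cs) = reynolds_form G m \<rho> cs" if h: "h \<in> carrier G" for h
  proof -
    let ?k = "inv\<^bsub>G\<^esub> h"
    have k: "?k \<in> carrier G" using h by simp
    have "action G m \<rho> h (vec_form m (transpose_mat (\<rho> g) *\<^sub>v c)) =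
        vec_form m (transpose_mat (\<rho> (g \<otimes>\<^bsub>G\<^esub> ?k)) *\<^sub>v c)" if "g \<in> carrier G" "c \<in> set cs" for g c
    proof -
      have c: "c \<in> carrier_vec m" using cs that by auto
      have T: "transpose_mat (\<rho> g) \<in> carrier_mat m m" "transpose_mat (\<rho> ?k) \<in> carrier_mat m m"
        using car that k by auto
      have "transpose_mat (\<rho> (g \<otimes>\<^bsub>G\<^esub> ?k)) = transpose_mat (\<rho> ?k) * transpose_mat (\<rho> g)"
        using representation_mult[OF rep that(1) k] transpose_mult[OF car[OF that(1)] car[OF k]] by simp
      then show ?thesis
        using T c car[OF k] by (simp add: action_vec_form mult_mat_vec_carrier)
    qed
    then have "action G m \<rho> h (reynolds_form G m \<rho> cs) =
        (\<Sum>g\<in>carrier G. \<Prod>c\<leftarrow>cs. vec_form m (transpose_mat (\<rho> (g \<otimes>\<^bsub>G\<^esub> ?k)) *\<^sub>v c))"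
      unfolding reynolds_form_def action_sum action_prod_list
      by (intro sum.cong refl arg_cong[of _ _ prod_list] map_cong) auto
    also have "\<dots> = reynolds_form G m \<rho> cs"
      unfolding reynolds_form_def
      by (rule sum.reindex_bij_witness[of _ "\<lambda>g. g \<otimes>\<^bsub>G\<^esub> h" "\<lambda>g. g \<otimes>\<^bsub>G\<^esub> ?k"])
         (use h in \<open>auto simp: m_assoc\<close>)
    finally show ?thesis .
  qed
  then show ?thesis
    using reynolds_form_in_forms[of G m \<rho> cs] by (simp add: invariants_def forms_def)
qed

lemma mpoly_eval_reynolds_form:
  fixes \<rho> :: "'g \<Rightarrow> 'k::field mat"
  assumes rep: "representation G m \<rho>" and cs: "set cs \<subseteq> carrier_vec m" and v: "v \<in> carrier_vec m"
  shows "mpoly_eval (reynolds_form G m \<rho> cs) v = (\<Sum>g\<in>carrier G. \<Prod>c\<leftarrow>cs. c \<bullet> (\<rho> g *\<^sub>v v))"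
proof -
  have prod: "mpoly_eval (\<Prod>c\<leftarrow>ds. k c) v = (\<Prod>c\<leftarrow>ds. mpoly_eval (k c) v)" for k and ds :: "'k vec list"
    by (induction ds) (simp_all add: mpoly_eval_one mpoly_eval_mult)
  have "mpoly_eval (vec_form m (transpose_mat (\<rho> g) *\<^sub>v c)) v = c \<bullet> (\<rho> g *\<^sub>v v)"
    if "g \<in> carrier G" "c \<in> set cs" for g c
    using representation_carrier[OF rep that(1)] that(2) cs v
      transpose_vec_mult_scalar[of "\<rho> g" m m v c]
    by (subst mpoly_eval_vec_form) (auto intro!: mult_mat_vec_carrier)
  then show ?thesis
    unfolding reynolds_form_def mpoly_eval_sum prod
    by (intro sum.cong refl arg_cong[of _ _ prod_list] map_cong) auto
qed

lemma homogeneous_invariant_in_upto: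
  assumes f: "f \<in> invariants G m \<rho>" "homogeneous d f" and d: "d \<le> D"
  shows "f \<in> invariants_upto G m \<rho> D"
proof -
  have zero: "0 \<in> invariants G m \<rho>"
    by (auto simp: invariants_def coord_ring_def action_def mpoly_subst_def)
  have "f = (\<Sum>j\<le>D. if j = d then f else 0)" using d by simp
  then show ?thesis
    unfolding invariants_upto_def using f zero
    by (intro CollectI exI[of _ "\<lambda>j. if j = d then f else 0"]) (auto simp: homogeneous_def)
qed

lemma invariants_upto_subset: "invariants_upto G m \<rho> D \<subseteq> invariants G m \<rho>"
proof
  fix f assume "f \<in> invariants_upto G m \<rho> D"
  then obtain h where f: "f = (\<Sum>j\<le>D. h j)" and h: "\<And>j. j \<le> D \<Longrightarrow> h j \<in> invariants G m \<rho>"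
    by (auto simp: invariants_upto_def)
  have "(\<Sum>j\<le>D. h j) \<in> coord_ring m"
  proof -
    have "Poly_Mapping.keys (\<Sum>j\<le>D. h j) \<subseteq> (\<Union>j\<le>D. Poly_Mapping.keys (h j))"
      by (rule keys_sum)
    then show ?thesis using h by (fastforce simp: invariants_def coord_ring_def)
  qed
  then show "f \<in> invariants G m \<rho>"
    using h by (simp add: f invariants_def action_sum)
qed

text \<open>
  This is the only information about invariants that the upper bound uses.
\<close>

lemma agreement_on_invariants_upto:
  fixes \<rho> :: "'g \<Rightarrow> 'k::field mat"
  assumes G: "group G" and rep: "representation G m \<rho>"
    and v: "v \<in> carrier_vec m" and w: "w \<in> carrier_vec m"
    and agree: "\<And>f. f \<in> invariants_upto G m \<rho> D \<Longrightarrow> mpoly_eval f v = mpoly_eval f w"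
    and Fs: "\<And>F. F \<in> set Fs \<Longrightarrow> linear_fun m F" "length Fs \<le> D"
  shows "(\<Sum>g\<in>carrier G. \<Prod>F\<leftarrow>Fs. F (\<rho> g *\<^sub>v v)) = (\<Sum>g\<in>carrier G. \<Prod>F\<leftarrow>Fs. F (\<rho> g *\<^sub>v w))"
proof -
  define coef :: "('k vec \<Rightarrow> 'k) \<Rightarrow> 'k vec" where
    "coef F = (SOME c. c \<in> carrier_vec m \<and> (\<forall>v\<in>carrier_vec m. F v = c \<bullet> v))" for F
  have "coef F \<in> carrier_vec m \<and> (\<forall>v\<in>carrier_vec m. F v = coef F \<bullet> v)" if "linear_fun m F" for F
    unfolding coef_def by (rule someI_ex) (use that in \<open>auto simp: linear_fun_def\<close>)
  then have coef: "coef F \<in> carrier_vec m" "v \<in> carrier_vec m \<Longrightarrow> F v = coef F \<bullet> v"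
    if "linear_fun m F" for F v
    using that by auto
  define cs where "cs = map coef Fs"
  have cs: "set cs \<subseteq> carrier_vec m" using coef(1) Fs(1) by (auto simp: cs_def)
  have eval: "mpoly_eval (reynolds_form G m \<rho> cs) u = (\<Sum>g\<in>carrier G. \<Prod>F\<leftarrow>Fs. F (\<rho> g *\<^sub>v u))"
    if u: "u \<in> carrier_vec m" for u
  proof -
    have "mpoly_eval (reynolds_form G m \<rho> cs) u = (\<Sum>g\<in>carrier G. \<Prod>c\<leftarrow>cs. c \<bullet> (\<rho> g *\<^sub>v u))"
      by (rule mpoly_eval_reynolds_form[OF rep cs u])
    also have "\<dots> = (\<Sum>g\<in>carrier G. \<Prod>F\<leftarrow>Fs. F (\<rho> g *\<^sub>v u))"
    proof (rule sum.cong[OF refl])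
      fix g assume "g \<in> carrier G"
      then have "\<rho> g *\<^sub>v u \<in> carrier_vec m"
        using representation_carrier[OF rep] u by (intro mult_mat_vec_carrier)
      then have "map (\<lambda>c. c \<bullet> (\<rho> g *\<^sub>v u)) cs = map (\<lambda>F. F (\<rho> g *\<^sub>v u)) Fs"
        using coef(2) Fs(1) by (simp add: cs_def)
      then show "(\<Prod>c\<leftarrow>cs. c \<bullet> (\<rho> g *\<^sub>v u)) = (\<Prod>F\<leftarrow>Fs. F (\<rho> g *\<^sub>v u))"
        by (rule arg_cong)
    qed
    finally show ?thesis .
  qed
  have "reynolds_form G m \<rho> cs \<in> invariants_upto G m \<rho> D"
    using reynolds_form_invariant[OF G rep cs] reynolds_form_in_forms[of G m \<rho> cs] Fs(2)
    by (intro homogeneous_invariant_in_upto) (auto simp: forms_def cs_def)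
  from agree[OF this] show ?thesis using eval v w by simp
qed


section \<open>A module that needs degree n + 2\<close>

text \<open>
  The matrix of \<open>v \<mapsto> (c\<^sub>i v\<^bsub>\<pi> i\<^esub>)\<^sub>i\<close>. It permutes the monomials up to scalars, so that the condition of
  invariance can be read off coefficient by coefficient.
\<close>

definition monomial_mat :: "nat \<Rightarrow> (nat \<Rightarrow> nat) \<Rightarrow> (nat \<Rightarrow> 'k::field) \<Rightarrow> 'k mat" where
  "monomial_mat m \<pi> c = mat m m (\<lambda>(i, j). if j = \<pi> i then c i else 0)"

lemma monomial_mat_carrier: "monomial_mat m \<pi> c \<in> carrier_mat m m"
  by (simp add: monomial_mat_def)

lemma monomial_mat_mult:
  assumes "\<And>i. i < m \<Longrightarrow> \<pi> i < m"
  shows "monomial_mat m \<pi> c * monomial_mat m \<pi>' c' = monomial_mat m (\<lambda>i. \<pi>' (\<pi> i)) (\<lambda>i. c i * c' (\<pi> i))"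
proof (rule eq_matI)
  fix i j assume "i < dim_row (monomial_mat m (\<lambda>i. \<pi>' (\<pi> i)) (\<lambda>i. c i * c' (\<pi> i)))"
    "j < dim_col (monomial_mat m (\<lambda>i. \<pi>' (\<pi> i)) (\<lambda>i. c i * c' (\<pi> i)))"
  then have ij: "i < m" "j < m" by (simp_all add: monomial_mat_def)
  have "(monomial_mat m \<pi> c * monomial_mat m \<pi>' c') $$ (i, j) =
      (\<Sum>k\<in>{0..<m}. (if k = \<pi> i then c i else 0) * (if j = \<pi>' k then c' k else 0))"
    using ij by (simp add: monomial_mat_def scalar_prod_def)
  also have "\<dots> = (\<Sum>k\<in>{0..<m}. if k = \<pi> i then c i * (if j = \<pi>' k then c' k else 0) else 0)"
    by (intro sum.cong) auto
  also have "\<dots> = c i * (if j = \<pi>' (\<pi> i) then c' (\<pi> i) else 0)"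
    using assms[OF ij(1)] by (simp add: sum.delta)
  finally show "(monomial_mat m \<pi> c * monomial_mat m \<pi>' c') $$ (i, j) =
      monomial_mat m (\<lambda>i. \<pi>' (\<pi> i)) (\<lambda>i. c i * c' (\<pi> i)) $$ (i, j)"
    using ij by (simp add: monomial_mat_def)
qed (simp_all add: monomial_mat_def)

lemma monomial_mat_vec:
  assumes "\<And>i. i < m \<Longrightarrow> \<pi> i < m" and "v \<in> carrier_vec m" and "i < m"
  shows "(monomial_mat m \<pi> c *\<^sub>v v) $ i = c i * v $ \<pi> i"
proof -
  have "(monomial_mat m \<pi> c *\<^sub>v v) $ i = (\<Sum>k\<in>{0..<m}. (if k = \<pi> i then c i else 0) * v $ k)"
    using assms by (simp add: monomial_mat_def scalar_prod_def)
  also have "\<dots> = (\<Sum>k\<in>{0..<m}. if k = \<pi> i then c i * v $ k else 0)"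
    by (intro sum.cong) auto
  also have "\<dots> = c i * v $ \<pi> i" using assms(1)[OF assms(3)] by (simp add: sum.delta)
  finally show ?thesis .
qed

lemma linear_form_monomial_mat:
  assumes "i < m" and "\<pi> i < m"
  shows "linear_form m (monomial_mat m \<pi> c) i = Poly_Mapping.single (Poly_Mapping.single (\<pi> i) 1) (c i)"
proof -
  have "linear_form m (monomial_mat m \<pi> c) i =
      (\<Sum>j<m. if j = \<pi> i then Poly_Mapping.single (Poly_Mapping.single (\<pi> i) 1) (c i) else 0)"
    unfolding linear_form_def using assms by (intro sum.cong) (auto simp: monomial_mat_def)
  then show ?thesis using assms by simp
qed

definition permute_exponents :: "(nat \<Rightarrow> nat) \<Rightarrow> (nat \<Rightarrow>\<^sub>0 nat) \<Rightarrow> (nat \<Rightarrow>\<^sub>0 nat)" where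
  "permute_exponents \<pi> t = (\<Sum>i\<in>Poly_Mapping.keys t. Poly_Mapping.single (\<pi> i) (Poly_Mapping.lookup t i))"

lemma lookup_permute_exponents:
  assumes "\<And>i. \<pi> (\<pi> i) = i"
  shows "Poly_Mapping.lookup (permute_exponents \<pi> t) j = Poly_Mapping.lookup t (\<pi> j)"
proof -
  have "Poly_Mapping.lookup (permute_exponents \<pi> t) j =
      (\<Sum>i\<in>Poly_Mapping.keys t. if i = \<pi> j then Poly_Mapping.lookup t i else 0)"
    unfolding permute_exponents_def lookup_sum
    by (intro sum.cong refl) (use assms in \<open>auto simp: lookup_single when_def\<close>)
  also have "\<dots> = Poly_Mapping.lookup t (\<pi> j)" by (simp add: in_keys_iff)
  finally show ?thesis .
qed

lemma single_variable_power:
  "Poly_Mapping.single (Poly_Mapping.single j 1) a ^ k = Poly_Mapping.single (Poly_Mapping.single j k) (a ^ k)"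
  for a :: "'k::field" and j :: nat
  by (induction k) (simp_all add: mult_single single_add[symmetric])

lemma prod_single:
  "(\<Prod>i\<in>I. Poly_Mapping.single (s i) (a i)) = Poly_Mapping.single (\<Sum>i\<in>I. s i) (\<Prod>i\<in>I. a i)"
  for a :: "'i \<Rightarrow> 'k::field" and s :: "'i \<Rightarrow> nat \<Rightarrow>\<^sub>0 nat"
  by (induction I rule: infinite_finite_induct) (simp_all add: mult_single)

lemma action_monomial_mat:
  assumes A: "\<rho> (inv\<^bsub>G\<^esub> h) = monomial_mat m \<pi> c" and \<pi>: "\<And>i. i < m \<Longrightarrow> \<pi> i < m"
    and f: "f \<in> coord_ring m"
  shows "action G m \<rho> h f = (\<Sum>t\<in>Poly_Mapping.keys f. Poly_Mapping.single (permute_exponents \<pi> t)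
    (Poly_Mapping.lookup f t * (\<Prod>i\<in>Poly_Mapping.keys t. c i ^ Poly_Mapping.lookup t i)))"
  unfolding action_def mpoly_subst_def A
proof (rule sum.cong[OF refl])
  fix t assume "t \<in> Poly_Mapping.keys f"
  then have t: "Poly_Mapping.keys t \<subseteq> {..<m}" using f by (auto simp: coord_ring_def)
  have "(\<Prod>i\<in>Poly_Mapping.keys t. linear_form m (monomial_mat m \<pi> c) i ^ Poly_Mapping.lookup t i) =
      (\<Prod>i\<in>Poly_Mapping.keys t. Poly_Mapping.single (Poly_Mapping.single (\<pi> i) (Poly_Mapping.lookup t i))
        (c i ^ Poly_Mapping.lookup t i))"
  proof (rule prod.cong[OF refl])
    fix i assume "i \<in> Poly_Mapping.keys t"
    then have "i < m" using t by auto
    then show "linear_form m (monomial_mat m \<pi> c) i ^ Poly_Mapping.lookup t i =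
        Poly_Mapping.single (Poly_Mapping.single (\<pi> i) (Poly_Mapping.lookup t i)) (c i ^ Poly_Mapping.lookup t i)"
      using \<pi> by (simp only: linear_form_monomial_mat single_variable_power)
  qed
  then show "Poly_Mapping.single 0 (Poly_Mapping.lookup f t) *
      (\<Prod>i\<in>Poly_Mapping.keys t. linear_form m (monomial_mat m \<pi> c) i ^ Poly_Mapping.lookup t i) =
      Poly_Mapping.single (permute_exponents \<pi> t)
        (Poly_Mapping.lookup f t * (\<Prod>i\<in>Poly_Mapping.keys t. c i ^ Poly_Mapping.lookup t i))"
    by (simp add: prod_single mult_single permute_exponents_def)
qed

text \<open>
  The matrix multiplies a monomial \<open>t\<close> fixed by the permutation by a scalar, and sends no other monomial to a
  multiple of \<open>t\<close>. If \<open>t\<close> occurs in an invariant, the scalar must be 1.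
\<close>

lemma invariant_coefficient:
  fixes \<rho> :: "'g \<Rightarrow> 'k::field mat"
  assumes G: "group G" and g: "g \<in> carrier G" and f: "f \<in> invariants G m \<rho>"
    and A: "\<rho> g = monomial_mat m \<pi> c" and \<pi>: "\<And>i. i < m \<Longrightarrow> \<pi> i < m" "\<And>i. \<pi> (\<pi> i) = i"
    and t: "t \<in> Poly_Mapping.keys f" and fixed: "\<And>i. i \<in> Poly_Mapping.keys t \<Longrightarrow> \<pi> i = i"
  shows "(\<Prod>i\<in>Poly_Mapping.keys t. c i ^ Poly_Mapping.lookup t i) = 1"
proof -
  interpret group G by fact
  define h where "h = inv\<^bsub>G\<^esub> g"
  have h: "h \<in> carrier G" "inv\<^bsub>G\<^esub> h = g" using g by (simp_all add: h_def)
  have fc: "f \<in> coord_ring m" "action G m \<rho> h f = f" using f h by (auto simp: invariants_def)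
  let ?C = "\<lambda>t. \<Prod>i\<in>Poly_Mapping.keys t. c i ^ Poly_Mapping.lookup t i"
  have perm: "permute_exponents \<pi> s = t \<longleftrightarrow> s = t" for s
  proof -
    have t\<pi>: "Poly_Mapping.lookup t (\<pi> j) = Poly_Mapping.lookup t j" for j
    proof (cases "j \<in> Poly_Mapping.keys t")
      case False
      then have "\<pi> j \<notin> Poly_Mapping.keys t" using fixed[of "\<pi> j"] \<pi>(2)[of j] by auto
      with False show ?thesis by (simp add: in_keys_iff)
    qed (simp add: fixed)
    show ?thesis
    proof
      assume "s = t"
      then show "permute_exponents \<pi> s = t"
        by (intro poly_mapping_eqI) (simp add: lookup_permute_exponents[OF \<pi>(2)] t\<pi>)
    next
      assume st: "permute_exponents \<pi> s = t"
      have "Poly_Mapping.lookup s j = Poly_Mapping.lookup t j" for j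
      proof -
        have "Poly_Mapping.lookup t (\<pi> j) = Poly_Mapping.lookup s (\<pi> (\<pi> j))"
          by (simp only: st[symmetric] lookup_permute_exponents[OF \<pi>(2)])
        then show ?thesis using t\<pi>[of j] by (simp add: \<pi>(2))
      qed
      then show "s = t" by (rule poly_mapping_eqI)
    qed
  qed
  have act: "action G m \<rho> h f = (\<Sum>s\<in>Poly_Mapping.keys f. Poly_Mapping.single (permute_exponents \<pi> s)
      (Poly_Mapping.lookup f s * ?C s))"
    using A h(2) \<pi>(1) fc(1) by (intro action_monomial_mat) auto
  have "Poly_Mapping.lookup f t = Poly_Mapping.lookup (action G m \<rho> h f) t" by (simp add: fc)
  also have "\<dots> = (\<Sum>s\<in>Poly_Mapping.keys f. if s = t then Poly_Mapping.lookup f s * ?C s else 0)"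
    unfolding act lookup_sum
    by (intro sum.cong refl) (simp add: lookup_single when_def perm)
  also have "\<dots> = Poly_Mapping.lookup f t * ?C t" using t by simp
  finally show ?thesis using t by (simp add: in_keys_iff)
qed

lemma representationI:
  fixes \<rho> :: "'g \<Rightarrow> 'k::field mat"
  assumes G: "group G" and car: "\<And>g. g \<in> carrier G \<Longrightarrow> \<rho> g \<in> carrier_mat m m"
    and mult: "\<And>g h. g \<in> carrier G \<Longrightarrow> h \<in> carrier G \<Longrightarrow> \<rho> (g \<otimes>\<^bsub>G\<^esub> h) = \<rho> g * \<rho> h"
    and one: "\<rho> \<one>\<^bsub>G\<^esub> = 1\<^sub>m m"
  shows "representation G m \<rho>"
proof -
  interpret group G by fact
  have "\<rho> g \<in> Units (ring_mat TYPE('k) m ())" if g: "g \<in> carrier G" for g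
    unfolding Units_def ring_mat_simps
    using car g mult[of g "inv\<^bsub>G\<^esub> g"] mult[of "inv\<^bsub>G\<^esub> g" g] one
    by (auto intro!: bexI[of _ "\<rho> (inv\<^bsub>G\<^esub> g)"])
  then show ?thesis
    using mult by (simp add: representation_def GL_def hom_def units_of_carrier units_of_mult ring_mat_simps)
qed

text \<open>
  The module of the lower bound has coordinates \<open>x, y, s, t\<close>, numbered from 0 to 3. The element \<open>a\<^sup>i b\<^sup>s c\<^sup>e\<close>
  permutes them by \<open>flip_perm s\<close> and scales them by \<open>test_coeff\<close>. In the third case of that definition,
  \<open>s\<close> is negated by \<open>b\<close> and by \<open>c\<close>, hence exactly if one of the two is involved but not both.
\<close>

definition flip_perm :: "bool \<Rightarrow> nat \<Rightarrow> nat" where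
  "flip_perm s k = (if s \<and> k = 0 then 1 else if s \<and> k = 1 then 0 else k)"

definition test_coeff :: "'k::field \<Rightarrow> (int \<times> bool) \<times> int \<Rightarrow> nat \<Rightarrow> 'k" where
  "test_coeff \<zeta> = (\<lambda>((i, s), e) k.
     if k = 0 then \<zeta> powi i else if k = 1 then \<zeta> powi (- i)
     else if k = 2 then (if s = (e = 0) then - 1 else 1) else (if e = 0 then 1 else - 1))"

definition test_rep :: "'k::field \<Rightarrow> (int \<times> bool) \<times> int \<Rightarrow> 'k mat" where
  "test_rep \<zeta> g = monomial_mat 4 (flip_perm (snd (fst g))) (test_coeff \<zeta> g)"

lemma flip_perm_less: "i < 4 \<Longrightarrow> flip_perm s i < 4"
  and flip_perm_involution: "flip_perm s (flip_perm s i) = i"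
  by (auto simp: flip_perm_def)

lemma test_rep_representation:
  fixes \<zeta> :: "'k::field"
  assumes n: "n \<ge> 1" and \<zeta>: "\<zeta> ^ n = 1"
  shows "representation (dihedral_group n \<times>\<times> integer_mod_group 2) 4 (test_rep \<zeta>)"
proof (rule representationI)
  let ?G = "dihedral_group n \<times>\<times> integer_mod_group 2"
  show "group ?G" using n by (intro DirProd_group dihedral_is_group) auto
  show "test_rep \<zeta> g \<in> carrier_mat 4 4" for g
    by (simp add: test_rep_def monomial_mat_carrier)
  show "test_rep \<zeta> \<one>\<^bsub>?G\<^esub> = 1\<^sub>m 4"
    by (rule eq_matI) (auto simp: test_rep_def monomial_mat_def dihedral_one flip_perm_def test_coeff_def)
  have \<zeta>0: "\<zeta> \<noteq> 0" using \<zeta> n by (auto simp: power_0_left)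
  have per: "\<zeta> powi (k mod int n) = \<zeta> powi k" for k
  proof -
    have "\<zeta> powi k = \<zeta> powi (int n * (k div int n) + k mod int n)" by simp
    also have "\<dots> = (\<zeta> ^ n) powi (k div int n) * \<zeta> powi (k mod int n)"
      using \<zeta>0 by (simp only: power_int_add power_int_power simp_thms)
    finally show ?thesis by (simp add: \<zeta>)
  qed
  have per': "\<zeta> powi (- (k mod int n)) = \<zeta> powi (- k)" for k
    by (simp add: power_int_minus per)
  fix g h assume "g \<in> carrier ?G" "h \<in> carrier ?G"
  moreover obtain i s e j t f where g: "g = ((i, s), e)" and h: "h = ((j, t), f)"
    by (metis surj_pair)
  ultimately have e: "e = 0 \<or> e = 1" and f: "f = 0 \<or> f = 1"
    by (auto simp: carrier_integer_mod_group)
  have gh: "g \<otimes>\<^bsub>?G\<^esub> h = (((if s then i - j else i + j) mod int n, s \<noteq> t), (e + f) mod 2)"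
    by (simp add: g h dihedral_mult)
  have "test_rep \<zeta> g * test_rep \<zeta> h = monomial_mat 4 (\<lambda>k. flip_perm t (flip_perm s k))
      (\<lambda>k. test_coeff \<zeta> g k * test_coeff \<zeta> h (flip_perm s k))"
    unfolding test_rep_def by (subst monomial_mat_mult) (auto simp: g h flip_perm_less)
  also have "(\<lambda>k. flip_perm t (flip_perm s k)) = flip_perm (s \<noteq> t)"
    by (auto simp: flip_perm_def)
  also have "(\<lambda>k. test_coeff \<zeta> g k * test_coeff \<zeta> h (flip_perm s k)) = test_coeff \<zeta> (g \<otimes>\<^bsub>?G\<^esub> h)"
  proof
    fix k
    show "test_coeff \<zeta> g k * test_coeff \<zeta> h (flip_perm s k) = test_coeff \<zeta> (g \<otimes>\<^bsub>?G\<^esub> h) k"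
      unfolding gh using e f \<zeta>0
      by (cases s; cases t)
         (auto simp: g h test_coeff_def flip_perm_def per per' power_int_add power_int_diff power_int_minus field_simps)
  qed
  finally show "test_rep \<zeta> (g \<otimes>\<^bsub>?G\<^esub> h) = test_rep \<zeta> g * test_rep \<zeta> h"
    by (simp add: test_rep_def gh)
qed

definition test_point :: "'k::field \<Rightarrow> 'k vec" where
  "test_point a = vec 4 (\<lambda>i. if i = 1 then 0 else if i = 3 then a else 1)"

lemma prod_over_four_keys:
  fixes x :: "nat \<Rightarrow> 'r::comm_monoid_mult"
  assumes "Poly_Mapping.keys t \<subseteq> {..<4}"
  shows "(\<Prod>i\<in>Poly_Mapping.keys t. x i ^ Poly_Mapping.lookup t i) =
    x 0 ^ Poly_Mapping.lookup t 0 * x 1 ^ Poly_Mapping.lookup t 1 *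
    x 2 ^ Poly_Mapping.lookup t 2 * x 3 ^ Poly_Mapping.lookup t 3"
proof -
  have "(\<Prod>i\<in>Poly_Mapping.keys t. x i ^ Poly_Mapping.lookup t i) = (\<Prod>i<4. x i ^ Poly_Mapping.lookup t i)"
    using assms by (intro prod.mono_neutral_left) (auto simp: in_keys_iff)
  also have "{..<4::nat} = {0, 1, 2, 3}" by auto
  finally show ?thesis by (simp add: mult.assoc)
qed

lemma monom_degree_four:
  assumes "Poly_Mapping.keys t \<subseteq> {..<4}"
  shows "monom_degree t = Poly_Mapping.lookup t 0 + Poly_Mapping.lookup t 1 + Poly_Mapping.lookup t 2 + Poly_Mapping.lookup t 3"
proof -
  have "monom_degree t = (\<Sum>i<4. Poly_Mapping.lookup t i)"
    unfolding monom_degree_def using assms by (intro sum.mono_neutral_left) (auto simp: in_keys_iff)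
  also have "{..<4::nat} = {0, 1, 2, 3}" by auto
  finally show ?thesis by (simp add: add.assoc)
qed

text \<open>
  A monomial takes different values at the two points only if it has the form \<open>x\<^sup>i s\<^sup>k t\<^sup>l\<close> with \<open>l\<close> odd.
  If it occurs in an invariant, \<open>c\<close> forces \<open>k\<close> to be odd. In degree at most \<open>n + 1\<close> this leaves \<open>i < n\<close>,
  hence \<open>i = 0\<close> by \<open>a\<close>. But \<open>b\<close> negates \<open>s\<^sup>k t\<^sup>l\<close>.
\<close>

lemma low_degree_invariants_agree:
  fixes \<zeta> :: "'k::field"
  assumes n: "n \<ge> 2" and two: "(2::'k) \<noteq> 0"
    and \<zeta>: "\<zeta> ^ n = 1" "\<And>k. 0 < k \<Longrightarrow> k < n \<Longrightarrow> \<zeta> ^ k \<noteq> 1"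
    and f: "f \<in> invariants (dihedral_group n \<times>\<times> integer_mod_group 2) 4 (test_rep \<zeta>)"
      "homogeneous d f" and d: "d \<le> n + 1"
  shows "mpoly_eval f (test_point 1) = mpoly_eval f (test_point (- 1))"
proof -
  let ?G = "dihedral_group n \<times>\<times> integer_mod_group 2"
  have G: "group ?G" using n by (intro DirProd_group dihedral_is_group) auto
  have in_G: "((i, s), e) \<in> carrier ?G" if "0 \<le> i" "i < int n" "0 \<le> e" "e < 2" for i s e
    using that by (simp add: dihedral_carrier carrier_integer_mod_group)
  have neg1: "(- 1 :: 'k) \<noteq> 1" using two by (metis add.right_inverse one_add_one)
  have "(\<Prod>i\<in>Poly_Mapping.keys t. test_point 1 $ i ^ Poly_Mapping.lookup t i) =
      (\<Prod>i\<in>Poly_Mapping.keys t. test_point (- 1 :: 'k) $ i ^ Poly_Mapping.lookup t i)"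
    if t: "t \<in> Poly_Mapping.keys f" for t
  proof -
    have keys: "Poly_Mapping.keys t \<subseteq> {..<4}" using f(1) t by (auto simp: invariants_def coord_ring_def)
    define e0 e1 e2 e3 where "e0 = Poly_Mapping.lookup t 0" and "e1 = Poly_Mapping.lookup t 1"
      and "e2 = Poly_Mapping.lookup t 2" and "e3 = Poly_Mapping.lookup t 3"
    note e = e0_def[symmetric] e1_def[symmetric] e2_def[symmetric] e3_def[symmetric]
    have "monom_degree t = e0 + e1 + e2 + e3"
      by (simp only: monom_degree_four[OF keys] e)
    then have deg: "e0 + e1 + e2 + e3 \<le> n + 1"
      using f(2) t d by (auto simp: homogeneous_def)
    have coeff: "test_coeff \<zeta> g 0 ^ e0 * test_coeff \<zeta> g 1 ^ e1 * test_coeff \<zeta> g 2 ^ e2 * test_coeff \<zeta> g 3 ^ e3 = 1"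
      if "g \<in> carrier ?G" "\<And>i. i \<in> Poly_Mapping.keys t \<Longrightarrow> flip_perm (snd (fst g)) i = i" for g
      using invariant_coefficient[OF G that(1) f(1) test_rep_def flip_perm_less flip_perm_involution t that(2)]
      by (simp only: prod_over_four_keys[OF keys] e)
    have "e1 > 0 \<or> even e3"
    proof (rule ccontr)
      assume "\<not> (e1 > 0 \<or> even e3)"
      then have e1: "e1 = 0" and e3: "odd e3" by auto
      have "(- 1 :: 'k) ^ e2 * (- 1) ^ e3 = 1"
        using coeff[OF in_G[of 0 1 False]] n e1 by (simp add: flip_perm_def test_coeff_def)
      then have e2: "odd e2" using e3 neg1 by (cases "even e2") auto
      have "e0 < n" using deg e2 e3 e1 by (auto elim!: oddE)
      moreover have "\<zeta> ^ e0 = 1"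
        using coeff[OF in_G[of 1 0 False]] n e1 by (simp add: flip_perm_def test_coeff_def)
      ultimately have e0: "e0 = 0" using \<zeta>(2)[of e0] by (cases "e0 = 0") auto
      have "flip_perm True i = i" if "i \<in> Poly_Mapping.keys t" for i
      proof -
        have "i \<noteq> 0" "i \<noteq> 1" using that e0 e1 unfolding e0_def e1_def in_keys_iff by metis+
        then show ?thesis by (simp add: flip_perm_def)
      qed
      then have "(- 1 :: 'k) ^ e2 = 1"
        using coeff[OF in_G[of 0 0 True]] n e0 e1 by (simp add: test_coeff_def)
      then show False using e2 neg1 by simp
    qed
    then show ?thesis
      unfolding prod_over_four_keys[OF keys] e by (auto simp: test_point_def power_0_left)
  qed
  then show ?thesis by (simp add: mpoly_eval_def mpoly_subst_def)
qed

lemma test_points_not_same_orbit: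
  fixes \<zeta> :: "'k::field"
  assumes two: "(2::'k) \<noteq> 0"
  shows "\<not> same_orbit (dihedral_group n \<times>\<times> integer_mod_group 2) (test_rep \<zeta>) (test_point 1) (test_point (- 1))"
proof
  assume "same_orbit (dihedral_group n \<times>\<times> integer_mod_group 2) (test_rep \<zeta>) (test_point 1) (test_point (- 1))"
  then obtain i s e where eq: "test_point (- 1) = test_rep \<zeta> ((i, s), e) *\<^sub>v test_point 1"
    by (auto simp: same_orbit_def)
  have neg1: "(- 1 :: 'k) \<noteq> 1" using two by (metis add.right_inverse one_add_one)
  have val: "test_point (- 1) $ k = test_coeff \<zeta> ((i, s), e) k * test_point 1 $ flip_perm s k" if "k < 4" for k
    unfolding eq test_rep_def using that
    by (subst monomial_mat_vec) (auto simp: flip_perm_less test_point_def)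
  have s: "\<not> s" using val[of 0] by (auto simp: test_point_def flip_perm_def)
  show False
    using val[of 2] val[of 3] s neg1
    by (auto simp: test_point_def flip_perm_def test_coeff_def split: if_splits)
qed

theorem theorem2p2:
  fixes n :: nat
  assumes "n \<ge> 2" and "even n"
    and "\<not> CHAR('k::field) dvd order (dihedral_group n \<times>\<times> integer_mod_group 2)"
    and "\<exists>\<zeta>::'k. \<zeta> ^ n = 1 \<and> (\<forall>k. 0 < k \<and> k < n \<longrightarrow> \<zeta> ^ k \<noteq> 1)"
  shows "beta_sep TYPE('k) (dihedral_group n \<times>\<times> integer_mod_group 2) = enat (n + 2)"
proof -
  let ?G = "dihedral_group n \<times>\<times> integer_mod_group 2"
  obtain \<zeta> :: 'k where \<zeta>: "\<zeta> ^ n = 1" "\<And>k. 0 < k \<Longrightarrow> k < n \<Longrightarrow> \<zeta> ^ k \<noteq> 1"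
    using assms(4) by blast
  have "order ?G = 2 * n * 2"
    by (simp add: order_def dihedral_carrier carrier_integer_mod_group card_cartesian_product)
  then have "(of_nat (2 * n * 2) :: 'k) \<noteq> 0"
    using assms(3) by (metis of_nat_eq_0_iff_char_dvd)
  then have "(2::'k) * of_nat n * 2 \<noteq> 0" by (simp only: of_nat_mult of_nat_numeral not_False_eq_True)
  then have two: "(2::'k) \<noteq> 0" and n0: "(of_nat n :: 'k) \<noteq> 0"
    by (metis mult_zero_left, metis mult_zero_left mult_zero_right)
  have upper: "beta_sep_module ?G m \<rho> \<le> enat (n + 2)" if rep: "representation ?G m \<rho>"
    for m and \<rho> :: "(int \<times> bool) \<times> int \<Rightarrow> 'k mat"
  proof -
    interpret dihedral_times_two_module n m \<rho> \<zeta>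
      using assms(1,2) rep two n0 \<zeta> by unfold_locales
    have "separating_set ?G m \<rho> (invariants_upto ?G m \<rho> (n + 2))"
      unfolding separating_set_def
    proof (intro conjI ballI impI invariants_upto_subset)
      fix v w assume v: "v \<in> carrier_vec m" and w: "w \<in> carrier_vec m"
        and agree: "\<forall>f\<in>invariants_upto ?G m \<rho> (n + 2). mpoly_eval f v = mpoly_eval f w"
      show "same_orbit ?G \<rho> v w"
        using v w
      proof (rule agreement_implies_same_orbit)
        fix Fs :: "('k vec \<Rightarrow> 'k) list"
        assume "\<And>F. F \<in> set Fs \<Longrightarrow> linear_fun m F" "length Fs \<le> n + 2"
        then show "(\<Sum>g\<in>carrier ?G. \<Prod>F\<leftarrow>Fs. F (act g v)) = (\<Sum>g\<in>carrier ?G. \<Prod>F\<leftarrow>Fs. F (act g w))"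
          unfolding act_def using agree
          by (intro agreement_on_invariants_upto[OF G_group rep v w]) auto
      qed
    qed
    then show ?thesis unfolding beta_sep_module_def by (intro INF_lower) simp
  qed
  have rep: "representation ?G 4 (test_rep \<zeta>)"
    using assms(1) \<zeta>(1) by (intro test_rep_representation) auto
  have lower: "enat (n + 2) \<le> beta_sep_module ?G 4 (test_rep \<zeta>)"
    unfolding beta_sep_module_def
  proof (rule INF_greatest)
    fix d assume "d \<in> {d. separating_set ?G 4 (test_rep \<zeta>) (invariants_upto ?G 4 (test_rep \<zeta>) d)}"
    then have sep: "separating_set ?G 4 (test_rep \<zeta>) (invariants_upto ?G 4 (test_rep \<zeta>) d)" by simp
    show "enat (n + 2) \<le> enat d"
    proof (rule ccontr)
      assume "\<not> enat (n + 2) \<le> enat d"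
      then have d: "d \<le> n + 1" by simp
      have "mpoly_eval f (test_point 1) = mpoly_eval f (test_point (- 1))"
        if "f \<in> invariants_upto ?G 4 (test_rep \<zeta>) d" for f
      proof -
        obtain h where h: "f = (\<Sum>j\<le>d. h j)"
          "\<And>j. j \<le> d \<Longrightarrow> h j \<in> invariants ?G 4 (test_rep \<zeta>)" "\<And>j. j \<le> d \<Longrightarrow> homogeneous j (h j)"
          using \<open>f \<in> invariants_upto ?G 4 (test_rep \<zeta>) d\<close> by (auto simp: invariants_upto_def)
        have "mpoly_eval (h j) (test_point 1) = mpoly_eval (h j) (test_point (- 1))" if "j \<le> d" for j
          using low_degree_invariants_agree[OF assms(1) two \<zeta> h(2,3)[OF that]] that d by simp
        then show ?thesis by (simp add: h(1) mpoly_eval_sum)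
      qed
      moreover have "test_point 1 \<in> carrier_vec 4" "test_point (- 1) \<in> carrier_vec 4" 
        by (simp_all add: test_point_def)
      ultimately have "same_orbit ?G (test_rep \<zeta>) (test_point 1) (test_point (- 1))"
        using sep unfolding separating_set_def by blast
      then show False using test_points_not_same_orbit[OF two] by blast
    qed
  qed
  show ?thesis
  proof (rule antisym)
    show "beta_sep TYPE('k) ?G \<le> enat (n + 2)"
      unfolding beta_sep_def using upper by (intro SUP_least) auto
    have "beta_sep_module ?G 4 (test_rep \<zeta>) \<le> beta_sep TYPE('k) ?G"
      unfolding beta_sep_def by (rule SUP_upper2[of "(4, test_rep \<zeta>)"]) (use rep in auto)
    with lower show "enat (n + 2) \<le> beta_sep TYPE('k) ?G" by (rule order_trans)
  qed
qed

end
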